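(* Let $L\colon\mathbb{R}^d\to\mathbb{R}$ be an affine functional, let $l\subseteq\mathbb{R}^d$ be an affine subspace, and let $x\in\widetilde{E}(L,l)$. Then at least one of the following two statements holds: (1) There exists a line $m$ such that $x\in m\subseteq E(x,L,l)$. (2) There exists a generalized simplex $C$ such that $x\in\operatorname{ri} C$, $V_{\mathrm{fin}}(C)\subseteq\partial E_{>0}$ and $C\subseteq\operatorname{clos}(E(x,L,l))$. Moreover, if (2) holds, then the simplex $C$ in (2) can be required to satisfy the additional restrictions $C\setminus V_{\mathrm{fin}}(C)\subseteq E(x,L,l)$ and $\#(V_{\mathrm{dir}}(C))\leqslant 1$.
   Context: Segments: $[a,b]=\{(1-t)a+tb: 0\le t\le 1\}$, $(a,b)=\{(1-t)a+tb: 0<t<1\}$. $\overline{\mathbb{R}}=\mathbb{R}\cup\{-\infty,+\infty\}$. An $\overline{\mathbb{R}}$-valued function $B$ on a convex set is concave if its subgraph $\{(z,t): t\in\mathbb{R},\ t\le B(z)\}$ is convex. A function $B\colon\Omega\to\overline{\mathbb{R}}$ on $\Omega\subseteq\mathbb{R}^d$ is locally concave if its restriction to every segment contained in $\Omega$ is concave. Given $\Omega\subseteq\mathbb{R}^d$ and $f\colon\Omega\to\overline{\mathbb{R}}$, the minimal locally concave function is $\mathcal{B}(x)=\inf\{B(x): B\colon\Omega\to\overline{\mathbb{R}}\text{ locally concave},\ B\ge f\text{ on }\Omega\}$. Standing assumption: $\mathcal{B}$ is finite at every point of $\operatorname{int}\Omega$. Let $\overline{f}(y)=\limsup_{z\in\Omega,\,z\to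 y}f(z)$ for $y\in\operatorname{clos}\Omega$ be the upper semicontinuous majorant of $f$ ($z=y$ is allowed if $y\in\Omega$), $E_0=\{x\in\operatorname{int}\Omega:\mathcal{B}(x)=\overline{f}(x)\}$, and $E_{>0}=\operatorname{int}\Omega\setminus E_0$ (an open set). Closure, interior and boundary are in $\mathbb{R}^d$; $\operatorname{ri}$ is the relative interior (interior in the affine hull). For a closed convex set $W\subseteq E_{>0}$ with nonempty interior and an affine functional $L$ with $\mathcal{B}|_W\le L|_W$ put $U(W,L)=\{x\in W:\mathcal{B}(x)=L(x)\}$ (a closed convex set). A convex subset $F$ of a convex set $U$ is a face of $U$ if for all $y,z\in U$ with $(y,z)\cap F\neq\varnothing$ one has $[y,z]\subseteq F$. The pre-extremal set $\widetilde{E}(L,l)$, for an affine functional $L$ and an affine subspace $l$ of $\mathbb{R}^d$, is the set of points $x\in E_{>0}\cap l$ for which there is a closed convex $W\subseteq E_{>0}$ with nonempty interior such that $x\in\operatorname{int}W$, $\mathcal{B}|_W\le L|_W$, $x\in U(W,L)$, and $l\cap U(W,L)$ is a face of $U(W,L)$ with $\operatorname{aff}(l\cap U(W,L))=l$. For $x\in\widetilde{E}(L,l)$ the extremal set $E(x,L,l)$ is the connected component of $x$ in $\widetilde{E}(L,l)$. Directions: $\vec{S}^{d-1}$ is a copy of the unit sphere $S^{d-1}$; the element corresponding to $e\in S^{d-1}$ is written $\vec{e}$ (a point at infinity). For nonempty $V\subseteq\mathbb{R}^d$ and $E\subseteq\vec{S}^{d-1}$, let $\operatorname{ray}E=\{0\}\cup\{\alpha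 e:\alpha\ge 0,\vec{e}\in E\}$, $\operatorname{conv}(V;E)=\operatorname{conv}(V+\operatorname{ray}E)$, $\operatorname{aff}(V;E)=\operatorname{aff}(V+\operatorname{ray}E)$. The pair $(V;E)$ is affinely independent if $\dim\operatorname{aff}(V;E)=\#V+\#E-1$. A generalized simplex is a set $C=\operatorname{conv}(V;E)$ with $V\ne\varnothing$ and $(V;E)$ affinely independent; then $V_{\mathrm{fin}}(C)=V$ (finite vertices) and $V_{\mathrm{dir}}(C)=E$ (vertices at infinity). *)

theory Defs
  imports "HOL-Analysis.Analysis"
begin

text \<open>
  Functions on a set \<open>\<Omega>\<close> with values in the extended reals are total functions
  into \<^typ>\<open>ereal\<close> whose values outside \<open>\<Omega>\<close> are never used.
\<close>

definition concave_ereal_on :: "'a::real_vector set \<Rightarrow> ('a \<Rightarrow> ereal) \<Rightarrow> bool" where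
  "concave_ereal_on S B \<longleftrightarrow> convex {(z, t::real). z \<in> S \<and> ereal t \<le> B z}"

definition locally_concave_on :: "'a::real_vector set \<Rightarrow> ('a \<Rightarrow> ereal) \<Rightarrow> bool" where
  "locally_concave_on \<Omega> B \<longleftrightarrow>
     (\<forall>a b. closed_segment a b \<subseteq> \<Omega> \<longrightarrow> concave_ereal_on (closed_segment a b) B)"

definition min_loc_concave :: "'a::real_vector set \<Rightarrow> ('a \<Rightarrow> ereal) \<Rightarrow> 'a \<Rightarrow> ereal" where
  "min_loc_concave \<Omega> f x =
     Inf {B x | B. locally_concave_on \<Omega> B \<and> (\<forall>y\<in>\<Omega>. f y \<le> B y)}"

text \<open>
  The filter \<open>inf (nhds y) (principal \<Omega>)\<close> rather than \<open>at y within \<Omega>\<close>: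
  the point \<open>y\<close> itself is allowed in the limes superior when it lies in \<open>\<Omega>\<close>.
\<close>

definition usc_majorant :: "'a::topological_space set \<Rightarrow> ('a \<Rightarrow> ereal) \<Rightarrow> 'a \<Rightarrow> ereal" where
  "usc_majorant \<Omega> f y = Limsup (inf (nhds y) (principal \<Omega>)) f"

definition E_zero :: "'a::euclidean_space set \<Rightarrow> ('a \<Rightarrow> ereal) \<Rightarrow> 'a set" where
  "E_zero \<Omega> f = {x \<in> interior \<Omega>. min_loc_concave \<Omega> f x = usc_majorant \<Omega> f x}"

definition E_pos :: "'a::euclidean_space set \<Rightarrow> ('a \<Rightarrow> ereal) \<Rightarrow> 'a set" where
  "E_pos \<Omega> f = interior \<Omega> - E_zero \<Omega> f"

definition affine_functional :: "('a::real_vector \<Rightarrow> real) \<Rightarrow> bool" where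
  "affine_functional L \<longleftrightarrow> (\<exists>g c. linear g \<and> L = (\<lambda>x. g x + c))"

definition contact_set ::
  "'a::euclidean_space set \<Rightarrow> ('a \<Rightarrow> ereal) \<Rightarrow> 'a set \<Rightarrow> ('a \<Rightarrow> real) \<Rightarrow> 'a set" where
  "contact_set \<Omega> f W L = {x \<in> W. min_loc_concave \<Omega> f x = ereal (L x)}"

definition pre_extremal_set ::
  "'a::euclidean_space set \<Rightarrow> ('a \<Rightarrow> ereal) \<Rightarrow> ('a \<Rightarrow> real) \<Rightarrow> 'a set \<Rightarrow> 'a set" where
  "pre_extremal_set \<Omega> f L l =
     {x \<in> E_pos \<Omega> f \<inter> l.
        \<exists>W. closed W \<and> convex W \<and> W \<subseteq> E_pos \<Omega> f \<and> interior W \<noteq> {} \<and>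
            x \<in> interior W \<and>
            (\<forall>y\<in>W. min_loc_concave \<Omega> f y \<le> ereal (L y)) \<and>
            x \<in> contact_set \<Omega> f W L \<and>
            (l \<inter> contact_set \<Omega> f W L) face_of (contact_set \<Omega> f W L) \<and>
            affine hull (l \<inter> contact_set \<Omega> f W L) = l}"

definition extremal_set ::
  "'a::euclidean_space set \<Rightarrow> ('a \<Rightarrow> ereal) \<Rightarrow> 'a \<Rightarrow> ('a \<Rightarrow> real) \<Rightarrow> 'a set \<Rightarrow> 'a set" where
  "extremal_set \<Omega> f x L l = connected_component_set (pre_extremal_set \<Omega> f L l) x"

text \<open>
  A set of directions (points at infinity) is a subset \<open>D\<close> of the unit sphere. Finite
  vertices and directions are always kept in separate arguments, so a formally
  disjoint copy of the sphere is not needed.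
\<close>

definition ray :: "'a::real_vector set \<Rightarrow> 'a set" where
  "ray D = {0} \<union> {\<alpha> *\<^sub>R e | \<alpha> e. 0 \<le> \<alpha> \<and> e \<in> D}"

definition gen_conv :: "'a::real_vector set \<Rightarrow> 'a set \<Rightarrow> 'a set" where
  "gen_conv V D = convex hull {v + r | v r. v \<in> V \<and> r \<in> ray D}"

definition gen_aff :: "'a::real_vector set \<Rightarrow> 'a set \<Rightarrow> 'a set" where
  "gen_aff V D = affine hull {v + r | v r. v \<in> V \<and> r \<in> ray D}"

text \<open>
  Finiteness is explicit because \<^const>\<open>card\<close> is 0 on infinite sets.
\<close>

definition gen_affinely_independent :: "'a::euclidean_space set \<Rightarrow> 'a set \<Rightarrow> bool" where
  "gen_affinely_independent V D \<longleftrightarrow>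
     finite V \<and> finite D \<and> aff_dim (gen_aff V D) = int (card V) + int (card D) - 1"

text \<open>
  \<open>gen_simplex C V D\<close>: the set \<open>C\<close> is a generalized simplex with finite vertices \<open>V\<close>
  and vertices at infinity \<open>D\<close>.  (\<open>V\<close> and \<open>D\<close> are determined by \<open>C\<close>: they are its
  extreme points and the directions of its extreme rays.)
\<close>

definition gen_simplex :: "'a::euclidean_space set \<Rightarrow> 'a set \<Rightarrow> 'a set \<Rightarrow> bool" where
  "gen_simplex C V D \<longleftrightarrow>
     V \<noteq> {} \<and> D \<subseteq> sphere 0 1 \<and> gen_affinely_independent V D \<and> C = gen_conv V D"

end

theory Submission
  imports Defs
begin

text \<open>
  Write \<open>G\<close> for the open set \<open>E_pos \<Omega> f\<close> and \<open>E\<close> for the extremal set of \<open>x\<close>.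
  The proof has an analytic half, which extracts three properties of \<open>E\<close>, and a half that
  is pure convex geometry and uses nothing about \<open>E\<close> but these properties:
  \<open>E\<close> is closed relative to \<open>G\<close>; a segment that joins two points of \<open>E\<close> inside \<open>G\<close> lies in \<open>E\<close>;
  and every point of \<open>E\<close> is the midpoint of a nondegenerate segment in \<open>E\<close>.  The set \<open>G\<close>
  may have holes, so \<open>E\<close> itself need not be convex.

  Analytic half.  Near a pre-extremal point every convex neighbourhood inside \<open>G\<close> is as good a
  witness as the given one, because contact with \<open>L\<close>, the inequality against \<open>L\<close> and the face
  property are all preserved by shrinking towards the point (\<open>witness_transfer\<close>).  This gives
  the first two properties.  For the third, suppose that \<open>y\<close> were an extreme point of the
  contact set in a small ball.  Tilting \<open>L\<close> slightly makes it smaller than the minimal function at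
  \<open>y\<close> but still at least as large on the boundary sphere; replacing the minimal function in the ball by the
  minimum of the two keeps it locally concave and above \<open>f\<close>, which contradicts minimality
  (\<open>no_extreme_contact\<close>).

  Geometric half.  Seen from \<open>x\<close> along segments inside the closure of \<open>E\<close>, there are visible
  points of the frontier of \<open>G\<close> and visible directions at infinity.  In homogeneous coordinates
  in \<open>\<real> \<times> \<real>\<^sup>d\<close>, with \<open>(1, a)\<close> for a point and \<open>(0, e)\<close> for a direction, and
  normalized to length one, they form a compact set, the \<open>horizon\<close> of \<open>x\<close>.

  If \<open>(1, x)\<close> is a nonnegative combination of the horizon, take such a combination
  of least total weight.  Because the sphere is strictly convex, no point of the horizon is a
  nonnegative combination of the chosen generators except these generators themselves.  Now let a
  simplex with these vertices grow from \<open>x\<close>.  The first frontier point that it meets would be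
  visible, hence such a forbidden combination; so the full simplex lies in the closure of \<open>E\<close>, and
  it meets the frontier only in its finite vertices.  Two vertices at infinity could be
  replaced by the direction of their weighted sum, which is visible too, at a lower total weight; so
  there is at most one.  This is \<open>simplex_if_balanced\<close>.

  Conversely, each simplex as in the second alternative exhibits \<open>(1, x)\<close> as a
  combination of the horizon (\<open>balanced_if_simplex\<close>), which gives the refined version of the second
  alternative whenever the plain one holds.  If \<open>(1, x)\<close> is no such combination, then either zero is a
  convex combination of the horizon, and then it involves only directions and they span a subspace
  through \<open>x\<close> inside \<open>E\<close>; or a hyperplane separates, and then the part of \<open>E\<close> that is visible
  from \<open>x\<close> on the side away from the horizon is compact and convex.  An extreme point of its
  face furthest from the hyperplane contradicts the third property.
\<close>

section \<open>Least-weight representations over the unit sphere\<close>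

lemma convex_sum_plus_one:
  fixes C :: "'b::real_vector set"
  assumes "convex C" "finite I" "\<And>i. i \<in> I \<Longrightarrow> y i \<in> C" "k \<in> C"
    and "\<And>i. i \<in> I \<Longrightarrow> 0 \<le> w i" "0 \<le> r" "sum w I + r = 1"
  shows "(\<Sum>i\<in>I. w i *\<^sub>R y i) + r *\<^sub>R k \<in> C"
proof -
  let ?w = "\<lambda>j. case j of None \<Rightarrow> r | Some i \<Rightarrow> w i"
  let ?y = "\<lambda>j. case j of None \<Rightarrow> k | Some i \<Rightarrow> y i"
  have "(\<Sum>j\<in>insert None (Some ` I). ?w j *\<^sub>R ?y j) \<in> C"
    using assms by (intro convex_sum) (auto simp: sum.reindex add.commute)
  thus ?thesis
    using assms by (simp add: sum.reindex add.commute)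
qed

lemma small_multiple_le:
  fixes u \<nu> :: "'b \<Rightarrow> real"
  assumes "finite I" "\<And>i. i \<in> I \<Longrightarrow> 0 < u i"
  shows "\<exists>\<epsilon>>0. \<forall>\<kappa>. 0 \<le> \<kappa> \<and> \<kappa> \<le> \<epsilon> \<longrightarrow> (\<forall>i\<in>I. \<kappa> * \<nu> i \<le> u i)"
  using assms
proof (induction I rule: finite_induct)
  case empty
  show ?case by (auto intro: exI[of _ 1])
next
  case (insert j I)
  then obtain \<epsilon> where \<epsilon>: "\<epsilon> > 0" "\<And>\<kappa> i. 0 \<le> \<kappa> \<Longrightarrow> \<kappa> \<le> \<epsilon> \<Longrightarrow> i \<in> I \<Longrightarrow> \<kappa> * \<nu> i \<le> u i"
    by auto
  have uj: "u j > 0" using insert by auto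
  define \<delta> where "\<delta> = u j / (\<bar>\<nu> j\<bar> + 1)"
  have "\<delta> > 0" unfolding \<delta>_def using uj by (simp add: divide_pos_pos)
  moreover have "\<kappa> * \<nu> j \<le> u j" if "0 \<le> \<kappa>" "\<kappa> \<le> \<delta>" for \<kappa>
  proof -
    have "\<kappa> * \<nu> j \<le> \<kappa> * (\<bar>\<nu> j\<bar> + 1)" using that by (intro mult_left_mono) auto
    also have "\<dots> \<le> \<delta> * (\<bar>\<nu> j\<bar> + 1)" using that by (intro mult_right_mono) auto
    also have "\<dots> = u j" unfolding \<delta>_def by simp
    finally show ?thesis .
  qed
  ultimately show ?case
    using \<epsilon> by (intro exI[of _ "min \<epsilon> \<delta>"]) auto
qed

text \<open>
  The weights are scaled so that the total weight is least, i.e. so that the multiple of \<open>z\<close> in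
  the convex hull of \<open>S\<close> is the largest.  If \<open>\<rho> k\<close> with \<open>k \<in> S\<close> is a combination of the generators
  with coefficients \<open>\<nu>\<close>, exchanging a little of this combination for \<open>\<rho> k\<close> must
  not lower the total weight, so \<open>\<Sum>\<nu> \<le> \<rho>\<close>.  For unit vectors the triangle inequality gives the
  opposite estimate, with equality only if all generators involved coincide with \<open>k\<close>.
  The same exchange with \<open>\<rho> = 0\<close> and coefficients of either sign shows that a minimal set of
  generators is linearly independent.
\<close>
lemma optimal_cone_representation:
  fixes S :: "'b::euclidean_space set"
  assumes S: "compact S" "S \<subseteq> sphere 0 1" and z: "z \<noteq> 0" "z \<in> convex_cone hull S"
  obtains I c where "finite I" "I \<subseteq> S" "independent I" "\<And>i. i \<in> I \<Longrightarrow> 0 < c i"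
    "(\<Sum>i\<in>I. c i *\<^sub>R i) = z"
    "\<And>k \<nu> \<rho> i. \<lbrakk>k \<in> S; 0 \<le> \<rho>; \<And>i. i \<in> I \<Longrightarrow> 0 \<le> \<nu> i; (\<Sum>i\<in>I. \<nu> i *\<^sub>R i) = \<rho> *\<^sub>R k;
        i \<in> I; 0 < \<nu> i\<rbrakk> \<Longrightarrow> i = k"
proof -
  let ?H = "convex hull S"
  obtain r p where rp: "r \<ge> 0" "p \<in> ?H" "z = r *\<^sub>R p"
    using z by (auto simp: convex_cone_hull_convex_hull)
  have r: "r > 0" using rp z by (cases "r = 0") auto
  have H: "compact ?H" by (simp add: S compact_convex_hull)
  define T where "T = {t. 0 \<le> t \<and> t *\<^sub>R z \<in> ?H}"
  have T1: "1 / r \<in> T" using rp r by (simp add: T_def)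
  have "closed T"
  proof -
    have "T = {0..} \<inter> (\<lambda>t. t *\<^sub>R z) -` ?H" by (auto simp: T_def)
    moreover have "closed ((\<lambda>t. t *\<^sub>R z) -` ?H)"
      by (intro continuous_closed_vimage compact_imp_closed H) (auto intro!: continuous_intros)
    ultimately show ?thesis by auto
  qed
  moreover have "bounded T"
  proof -
    obtain M where M: "\<And>y. y \<in> ?H \<Longrightarrow> norm y \<le> M"
      using compact_imp_bounded[OF H] by (auto simp: bounded_iff)
    have "norm t \<le> M / norm z" if "t \<in> T" for t
      using M[of "t *\<^sub>R z"] that z by (auto simp: T_def field_simps)
    thus ?thesis by (auto simp: bounded_iff)
  qed
  ultimately have "compact T" by (simp add: compact_eq_bounded_closed)
  then obtain \<tau> where \<tau>: "\<tau> \<in> T" "\<And>t. t \<in> T \<Longrightarrow> t \<le> \<tau>"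
    using compact_attains_sup[of T] T1 by auto
  have \<tau>0: "\<tau> > 0" using \<tau>(2)[OF T1] r by (smt (verit) divide_pos_pos)
  define b where "b = \<tau> *\<^sub>R z"
  have b: "b \<in> ?H" using \<tau> by (simp add: T_def b_def)
  let ?P = "\<lambda>J. finite J \<and> J \<subseteq> S \<and> b \<in> convex hull J"
  obtain J0 where "?P J0" using subsetD[OF equalityD1[OF caratheodory] b] by blast
  then obtain I where I: "finite I" "I \<subseteq> S" "b \<in> convex hull I"
    and Imin: "\<And>J. ?P J \<Longrightarrow> card I \<le> card J"
    using ex_has_least_nat[of ?P J0 card] by auto
  obtain u where u: "\<And>i. i \<in> I \<Longrightarrow> 0 \<le> u i" "sum u I = 1" "(\<Sum>i\<in>I. u i *\<^sub>R i) = b"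
    using I by (auto simp: convex_hull_finite)
  have no_zero: False if w: "\<And>i. i \<in> I \<Longrightarrow> 0 \<le> w i" "sum w I = 1" "(\<Sum>i\<in>I. w i *\<^sub>R i) = b"
    "j \<in> I" "w j = 0" for w j
  proof -
    have "sum w (I - {j}) = 1" "(\<Sum>i\<in>I-{j}. w i *\<^sub>R i) = b"
      using w I by (simp_all add: sum_diff1)
    hence "b \<in> convex hull (I - {j})"
      using w I by (subst convex_hull_finite) auto
    hence "card I \<le> card (I - {j})" using I by (intro Imin) auto
    thus False using w I by (metis card_Diff1_less leD)
  qed
  have upos: "0 < u i" if "i \<in> I" for i
    using u(1)[OF that] no_zero[of u i] u that by force
  \<comment> \<open>optimality: a combination worth more than \<open>\<rho>\<close> could be exchanged for \<open>\<rho> k\<close>\<close>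
  have core: "sum \<nu> I \<le> \<rho>" if k: "k \<in> S" "0 \<le> \<rho>" "(\<Sum>i\<in>I. \<nu> i *\<^sub>R i) = \<rho> *\<^sub>R k" for k \<nu> \<rho>
  proof (rule ccontr)
    assume "\<not> ?thesis"
    hence lt: "\<rho> < sum \<nu> I" by simp
    obtain \<epsilon> where \<epsilon>: "\<epsilon> > 0" "\<And>\<kappa>. 0 \<le> \<kappa> \<Longrightarrow> \<kappa> \<le> \<epsilon> \<Longrightarrow> \<forall>i\<in>I. \<kappa> * \<nu> i \<le> u i"
      using small_multiple_le[of I u \<nu>] I upos by auto
    define \<kappa> where "\<kappa> = min \<epsilon> (1 / (2 * (sum \<nu> I - \<rho>)))"
    have \<kappa>: "\<kappa> > 0" "\<kappa> \<le> \<epsilon>" using \<epsilon> lt by (auto simp: \<kappa>_def)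
    have "\<kappa> * (sum \<nu> I - \<rho>) \<le> 1 / (2 * (sum \<nu> I - \<rho>)) * (sum \<nu> I - \<rho>)"
      using lt by (intro mult_right_mono) (auto simp: \<kappa>_def)
    also have "\<dots> = 1 / 2" using lt by simp
    finally have half: "\<kappa> * (sum \<nu> I - \<rho>) \<le> 1 / 2" .
    define m where "m = 1 - \<kappa> * (sum \<nu> I - \<rho>)"
    have m: "0 < m" "m < 1" using half \<kappa> lt by (auto simp: m_def)
    have "(\<Sum>i\<in>I. ((u i - \<kappa> * \<nu> i) / m) *\<^sub>R i) + (\<kappa> * \<rho> / m) *\<^sub>R k \<in> ?H"
    proof (rule convex_sum_plus_one)
      show "i \<in> ?H" if "i \<in> I" for i using I that by (auto intro: hull_inc)
      show "k \<in> ?H" using k by (auto intro: hull_inc)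
      show "(\<Sum>i\<in>I. (u i - \<kappa> * \<nu> i) / m) + \<kappa> * \<rho> / m = 1"
        using m u by (simp add: m_def sum_divide_distrib[symmetric] sum_subtractf
            sum_distrib_left[symmetric] add_divide_distrib[symmetric] algebra_simps)
    qed (use I \<epsilon>(2)[of \<kappa>] \<kappa> m k in auto)
    also have "(\<Sum>i\<in>I. ((u i - \<kappa> * \<nu> i) / m) *\<^sub>R i) + (\<kappa> * \<rho> / m) *\<^sub>R k
        = (1 / m) *\<^sub>R ((\<Sum>i\<in>I. u i *\<^sub>R i) - \<kappa> *\<^sub>R (\<Sum>i\<in>I. \<nu> i *\<^sub>R i) + (\<kappa> * \<rho>) *\<^sub>R k)"
      by (simp add: scaleR_sum_right sum_subtractf[symmetric] scaleR_add_right scaleR_diff_right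
          diff_divide_distrib scaleR_diff_left)
    also have "\<dots> = (\<tau> / m) *\<^sub>R z" using u k by (simp add: b_def)
    finally have "\<tau> / m \<in> T" using m \<tau>0 by (simp add: T_def)
    hence "\<tau> / m \<le> \<tau>" by (rule \<tau>(2))
    thus False using m \<tau>0 by (simp add: field_simps)
  qed
  have I0: "I \<noteq> {}" using u by auto
  then obtain k0 where k0: "k0 \<in> S" using I by blast
  have indep: "independent I"
  proof (rule ccontr)
    assume "\<not> independent I"
    then obtain \<gamma>' where \<gamma>': "\<exists>j\<in>I. \<gamma>' j \<noteq> 0" "(\<Sum>i\<in>I. \<gamma>' i *\<^sub>R i) = 0"
      using I by (auto simp: dependent_finite)
    then obtain j' where j': "j' \<in> I" "\<gamma>' j' \<noteq> 0" by auto
    define \<gamma> where "\<gamma> i = sgn (\<gamma>' j') * \<gamma>' i" for i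
    have g: "(\<Sum>i\<in>I. \<gamma> i *\<^sub>R i) = 0" "\<gamma> j' > 0"
      using \<gamma>' j' by (auto simp: \<gamma>_def scaleR_sum_right[symmetric] scaleR_scaleR[symmetric]
           sgn_if simp del: scaleR_scaleR)
    have "sum \<gamma> I \<le> 0" using core[OF k0, of 0 \<gamma>] g by simp
    moreover have "sum (\<lambda>i. - \<gamma> i) I \<le> 0"
      using core[OF k0, of 0 "\<lambda>i. - \<gamma> i"] g by (simp add: sum_negf)
    ultimately have g0: "sum \<gamma> I = 0" by (simp add: sum_negf)
    define Q where "Q = {i \<in> I. \<gamma> i > 0}"
    have Q: "finite Q" "Q \<noteq> {}" using I j' g by (auto simp: Q_def)
    define \<kappa> where "\<kappa> = Min ((\<lambda>i. u i / \<gamma> i) ` Q)"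
    have "\<kappa> \<in> (\<lambda>i. u i / \<gamma> i) ` Q" unfolding \<kappa>_def using Q by (intro Min_in) auto
    then obtain j where j: "j \<in> Q" "\<kappa> = u j / \<gamma> j" by auto
    have \<kappa>le: "\<kappa> \<le> u i / \<gamma> i" if "i \<in> Q" for i
      unfolding \<kappa>_def using Q that by (intro Min_le) auto
    have \<kappa>0: "\<kappa> > 0" using j upos by (auto simp: Q_def)
    show False
    proof (rule no_zero[of "\<lambda>i. u i - \<kappa> * \<gamma> i" j])
      show "0 \<le> u i - \<kappa> * \<gamma> i" if "i \<in> I" for i
      proof (cases "\<gamma> i > 0")
        case True
        thus ?thesis using \<kappa>le[of i] that by (simp add: Q_def field_simps)
      next
        case False
        hence "\<kappa> * \<gamma> i \<le> 0" using \<kappa>0 by (simp add: mult_le_0_iff)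
        thus ?thesis using u(1)[OF that] by linarith
      qed
      show "(\<Sum>i\<in>I. u i - \<kappa> * \<gamma> i) = 1"
        using u g0 by (simp add: sum_subtractf sum_distrib_left[symmetric])
      have "(\<Sum>i\<in>I. (u i - \<kappa> * \<gamma> i) *\<^sub>R i) = (\<Sum>i\<in>I. u i *\<^sub>R i) - \<kappa> *\<^sub>R (\<Sum>i\<in>I. \<gamma> i *\<^sub>R i)"
        by (simp add: scaleR_sum_right sum_subtractf scaleR_diff_left)
      thus "(\<Sum>i\<in>I. (u i - \<kappa> * \<gamma> i) *\<^sub>R i) = b" using u g by simp
    qed (use j in \<open>auto simp: Q_def\<close>)
  qed
  \<comment> \<open>taking the inner product with \<open>k\<close> detects equality in the triangle inequality\<close>
  have opt: "i = k"
    if k: "k \<in> S" "0 \<le> \<rho>" "\<And>i. i \<in> I \<Longrightarrow> 0 \<le> \<nu> i" "(\<Sum>i\<in>I. \<nu> i *\<^sub>R i) = \<rho> *\<^sub>R k"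
      and i: "i \<in> I" "0 < \<nu> i" for k \<nu> \<rho> i
  proof -
    have nS: "norm s = 1" if "s \<in> S" for s using S that by auto
    have le1: "i \<bullet> k \<le> 1" if "i \<in> I" for i
      using norm_cauchy_schwarz[of i k] nS k I that by (metis mult_1 subsetD)
    have "\<rho> = (\<rho> *\<^sub>R k) \<bullet> k" using nS[OF k(1)] by (simp add: dot_square_norm)
    also have "\<dots> = (\<Sum>i\<in>I. \<nu> i * (i \<bullet> k))" by (simp add: k(4)[symmetric] inner_sum_left)
    finally have "(\<Sum>i\<in>I. \<nu> i * (1 - i \<bullet> k)) = sum \<nu> I - \<rho>"
      by (simp add: algebra_simps sum_subtractf)
    hence "(\<Sum>i\<in>I. \<nu> i * (1 - i \<bullet> k)) \<le> 0" using core[OF k(1,2,4)] by simp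
    moreover have nn: "0 \<le> \<nu> i * (1 - i \<bullet> k)" if "i \<in> I" for i
      using k(3)[OF that] le1[OF that] by simp
    ultimately have "(\<Sum>i\<in>I. \<nu> i * (1 - i \<bullet> k)) = 0" by (meson antisym sum_nonneg)
    hence "\<forall>i\<in>I. \<nu> i * (1 - i \<bullet> k) = 0"
      using nn I sum_nonneg_eq_0_iff[of I "\<lambda>i. \<nu> i * (1 - i \<bullet> k)"] by blast
    hence "i \<bullet> k = 1" using i by fastforce
    hence "(norm (i - k))\<^sup>2 = 0"
      using nS[OF k(1)] nS[of i] i I
      by (simp add: power2_norm_eq_inner inner_diff inner_commute norm_eq_1 subset_iff)
    thus "i = k" by simp
  qed
  have sum_z: "(\<Sum>i\<in>I. (u i / \<tau>) *\<^sub>R i) = z"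
  proof -
    have "(\<Sum>i\<in>I. (u i / \<tau>) *\<^sub>R i) = (1 / \<tau>) *\<^sub>R b"
      by (simp add: u(3)[symmetric] scaleR_sum_right)
    thus ?thesis using \<tau>0 by (simp add: b_def)
  qed
  show ?thesis
  proof (rule that[OF I(1,2) indep _ sum_z])
    show "0 < u i / \<tau>" if "i \<in> I" for i using upos[OF that] \<tau>0 by simp
  qed (rule opt)
qed

section \<open>Generalized simplices in homogeneous coordinates\<close>

text \<open>
  A pair \<open>(s, y)\<close> with \<open>s > 0\<close> is the point \<open>y / s\<close> in homogeneous coordinates, and \<open>(0, y)\<close>
  is the point at infinity in direction \<open>y\<close>.
\<close>
definition fin_points :: "(real \<times> 'a::real_vector) set \<Rightarrow> 'a set" where
  "fin_points I = (\<lambda>i. snd i /\<^sub>R fst i) ` {i \<in> I. 0 < fst i}"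

definition dir_points :: "(real \<times> 'a::real_vector) set \<Rightarrow> 'a set" where
  "dir_points I = snd ` {i \<in> I. fst i = 0}"

lemma convex_cone_hull_sum:
  assumes "finite I" "\<And>i. i \<in> I \<Longrightarrow> y i \<in> S" "\<And>i. i \<in> I \<Longrightarrow> 0 \<le> w i"
  shows "(\<Sum>i\<in>I. w i *\<^sub>R y i) \<in> convex_cone hull S"
  using assms
proof (induction I rule: finite_induct)
  case empty
  show ?case by (simp add: convex_cone_hull_contains_0)
next
  case (insert j I)
  have "y j \<in> convex_cone hull S" using insert by (simp add: hull_inc)
  hence "w j *\<^sub>R y j \<in> convex_cone hull S" using insert by (simp add: convex_cone_hull_mul)
  thus ?case using insert by (simp add: convex_cone_hull_add)
qed

lemma lifted_sum_eq:
  fixes I :: "(real \<times> 'a::real_vector) set"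
  shows "(\<Sum>i\<in>I. \<nu> i *\<^sub>R i) = (s, y) \<longleftrightarrow>
    (\<Sum>i\<in>I. \<nu> i * fst i) = s \<and> (\<Sum>i\<in>I. \<nu> i *\<^sub>R snd i) = y"
  by (auto simp: prod_eq_iff fst_sum snd_sum)

lemma lifted_combination:
  fixes I :: "(real \<times> 'a::real_vector) set"
  shows "(\<Sum>i\<in>I. \<nu> i *\<^sub>R i) = (1, y) \<longleftrightarrow>
    (\<Sum>i\<in>I. \<nu> i * fst i) = 1 \<and> x + (\<Sum>i\<in>I. \<nu> i *\<^sub>R (snd i - fst i *\<^sub>R x)) = y"
proof -
  have "x + (\<Sum>i\<in>I. \<nu> i *\<^sub>R (snd i - fst i *\<^sub>R x))
      = (\<Sum>i\<in>I. \<nu> i *\<^sub>R snd i) + (1 - (\<Sum>i\<in>I. \<nu> i * fst i)) *\<^sub>R x"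
    by (simp add: scaleR_diff_right sum_subtractf scaleR_diff_left scaleR_sum_left)
  thus ?thesis by (auto simp: lifted_sum_eq)
qed

lemma norm_lift_pos: "0 < norm (1::real, q)"
  by (simp add: zero_prod_def)

lemma normalized_lift: "norm (1::real, q) *\<^sub>R ((1::real, q) /\<^sub>R norm (1::real, q)) = (1, q)"
proof -
  have "norm (1::real, q) *\<^sub>R (inverse (norm (1::real, q)) *\<^sub>R (1::real, q))
      = (norm (1::real, q) * inverse (norm (1::real, q))) *\<^sub>R (1::real, q)"
    by (rule scaleR_scaleR)
  thus ?thesis using norm_lift_pos[of q] by simp
qed

lemma sum_delta_scaleR:
  fixes f :: "'b \<Rightarrow> 'c::real_vector"
  assumes "finite I" "j \<in> I"
  shows "(\<Sum>i\<in>I. (if i = j then a else 0) *\<^sub>R f i) = a *\<^sub>R f j"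
proof -
  have "(\<Sum>i\<in>I. (if i = j then a else 0) *\<^sub>R f i) = (\<Sum>i\<in>I. if i = j then a *\<^sub>R f i else 0)"
    by (rule sum.cong) simp_all
  thus ?thesis using assms by (simp add: sum.delta)
qed

text \<open>
  In homogeneous coordinates vertices and directions are treated alike: a generalized
  convex hull is a slice of the cone over its generators.  The only gap to bridge is that the hull
  is built from sums of one vertex and a multiple of one direction; a combination of several
  directions is reached by averaging over all pairs of a vertex and a direction.
\<close>
lemma gen_conv_lift:
  fixes I :: "(real \<times> 'a::real_vector) set"
  assumes fin: "finite I" and nonneg: "\<And>i. i \<in> I \<Longrightarrow> 0 \<le> fst i"
  shows "gen_conv (fin_points I) (dir_points I) =
    {y. \<exists>\<nu>. (\<forall>i\<in>I. 0 \<le> \<nu> i) \<and> (\<Sum>i\<in>I. \<nu> i *\<^sub>R i) = (1, y)}" (is "_ = ?R")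
proof
  show "gen_conv (fin_points I) (dir_points I) \<subseteq> ?R"
    unfolding gen_conv_def
  proof (rule hull_minimal)
    show "convex ?R"
    proof (rule convexI)
      fix y z and u v :: real
      assume "y \<in> ?R" "z \<in> ?R" and uv: "0 \<le> u" "0 \<le> v" "u + v = 1"
      then obtain \<nu> \<mu> where \<nu>: "\<forall>i\<in>I. 0 \<le> \<nu> i" "(\<Sum>i\<in>I. \<nu> i *\<^sub>R i) = (1, y)"
        and \<mu>: "\<forall>i\<in>I. 0 \<le> \<mu> i" "(\<Sum>i\<in>I. \<mu> i *\<^sub>R i) = (1, z)" by auto
      have "(\<Sum>i\<in>I. (u * \<nu> i + v * \<mu> i) *\<^sub>R i)
          = u *\<^sub>R (\<Sum>i\<in>I. \<nu> i *\<^sub>R i) + v *\<^sub>R (\<Sum>i\<in>I. \<mu> i *\<^sub>R i)"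
        by (simp add: scaleR_add_left sum.distrib scaleR_sum_right)
      also have "\<dots> = (1, u *\<^sub>R y + v *\<^sub>R z)" using \<nu> \<mu> uv by simp
      finally show "u *\<^sub>R y + v *\<^sub>R z \<in> ?R"
        using \<nu> \<mu> uv by (intro CollectI exI[of _ "\<lambda>i. u * \<nu> i + v * \<mu> i"]) auto
    qed
    show "{v + r |v r. v \<in> fin_points I \<and> r \<in> ray (dir_points I)} \<subseteq> ?R"
    proof clarify
      fix v r assume "v \<in> fin_points I" and r: "r \<in> ray (dir_points I)"
      then obtain i where i: "i \<in> I" "0 < fst i" "v = snd i /\<^sub>R fst i"
        by (auto simp: fin_points_def)
      let ?\<delta> = "\<lambda>k. if k = i then inverse (fst i) else 0"
      have \<delta>: "(\<Sum>k\<in>I. ?\<delta> k *\<^sub>R k) = (1, v)"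
        using sum_delta_scaleR[OF fin i(1), of "inverse (fst i)" "\<lambda>k. k"] i
        by (auto simp: prod_eq_iff)
      have \<delta>0: "\<forall>k\<in>I. 0 \<le> ?\<delta> k" using i by auto
      show "\<exists>\<nu>. (\<forall>i\<in>I. 0 \<le> \<nu> i) \<and> (\<Sum>i\<in>I. \<nu> i *\<^sub>R i) = (1, v + r)"
      proof (cases "r = 0")
        case True
        thus ?thesis using \<delta> \<delta>0 by auto
      next
        case False
        then obtain j \<alpha> where j: "j \<in> I" "fst j = 0" "0 \<le> \<alpha>" "r = \<alpha> *\<^sub>R snd j"
          using r by (auto simp: ray_def dir_points_def)
        have "(\<Sum>k\<in>I. (?\<delta> k + (if k = j then \<alpha> else 0)) *\<^sub>R k) = (1, v) + \<alpha> *\<^sub>R j"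
          using \<delta> sum_delta_scaleR[OF fin j(1), of \<alpha> "\<lambda>k. k"]
          by (simp only: scaleR_add_left sum.distrib)
        also have "\<dots> = (1, v + r)" using j by (simp add: prod_eq_iff)
        finally show ?thesis
          using \<delta>0 j by (intro exI[of _ "\<lambda>k. ?\<delta> k + (if k = j then \<alpha> else 0)"]) auto
      qed
    qed
  qed
next
  show "?R \<subseteq> gen_conv (fin_points I) (dir_points I)"
  proof clarify
    fix y \<nu> assume \<nu>: "\<forall>i\<in>I. 0 \<le> \<nu> i" "(\<Sum>i\<in>I. \<nu> i *\<^sub>R i) = (1, y)"
    define P where "P = {i \<in> I. 0 < fst i}"
    define J where "J = {i \<in> I. fst i = 0}"
    have "I = P \<union> J" using nonneg by (auto simp: P_def J_def order_le_less)
    moreover have "P \<inter> J = {}" by (auto simp: P_def J_def)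
    moreover have "finite P" "finite J" using fin by (auto simp: P_def J_def)
    ultimately have IJ: "I = P \<union> J" "P \<inter> J = {}" "finite P" "finite J" by blast+
    let ?S = "{v + r |v r. v \<in> fin_points I \<and> r \<in> ray (dir_points I)}"
    let ?a = "\<lambda>i::real \<times> 'a. snd i /\<^sub>R fst i"
    have one: "(\<Sum>i\<in>P. \<nu> i * fst i) = 1"
    proof -
      have "(\<Sum>i\<in>I. \<nu> i * fst i) = (\<Sum>i\<in>P. \<nu> i * fst i) + (\<Sum>i\<in>J. \<nu> i * fst i)"
        unfolding IJ(1) using IJ by (intro sum.union_disjoint) auto
      also have "(\<Sum>i\<in>J. \<nu> i * fst i) = 0" by (simp add: J_def)
      finally show ?thesis using \<nu> by (simp add: lifted_sum_eq)
    qed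
    have y: "y = (\<Sum>i\<in>P. (\<nu> i * fst i) *\<^sub>R ?a i) + (\<Sum>j\<in>J. \<nu> j *\<^sub>R snd j)"
    proof -
      have "(\<Sum>i\<in>I. \<nu> i *\<^sub>R snd i) = (\<Sum>i\<in>P. \<nu> i *\<^sub>R snd i) + (\<Sum>i\<in>J. \<nu> i *\<^sub>R snd i)"
        unfolding IJ(1) using IJ by (intro sum.union_disjoint) auto
      also have "(\<Sum>i\<in>P. \<nu> i *\<^sub>R snd i) = (\<Sum>i\<in>P. (\<nu> i * fst i) *\<^sub>R ?a i)"
        by (intro sum.cong) (auto simp: P_def)
      finally show ?thesis using \<nu> by (simp add: lifted_sum_eq)
    qed
    have w0: "0 \<le> \<nu> i * fst i" if "i \<in> P" for i using that \<nu> by (auto simp: P_def)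
    have "y \<in> convex hull ?S"
    proof (cases "J = {}")
      case True
      have "(\<Sum>i\<in>P. (\<nu> i * fst i) *\<^sub>R ?a i) \<in> convex hull ?S"
      proof (rule convex_sum[OF IJ(3) convex_convex_hull one w0])
        show "?a i \<in> convex hull ?S" if "i \<in> P" for i
        proof (rule hull_inc)
          show "?a i \<in> ?S"
            using that by (intro CollectI exI[of _ "?a i"] exI[of _ 0])
              (auto simp: P_def fin_points_def ray_def)
        qed
      qed
      thus ?thesis using y True by simp
    next
      case False
      define n where "n = real (card J)"
      have n: "n > 0" using False IJ by (simp add: n_def card_gt_0_iff)
      let ?w = "\<lambda>(i, j). \<nu> i * fst i / n"
      let ?z = "\<lambda>(i, j). ?a i + (n * \<nu> j) *\<^sub>R snd j"
      have "(\<Sum>k\<in>P\<times>J. ?w k *\<^sub>R ?z k) \<in> convex hull ?S"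
      proof (rule convex_sum)
        have "sum ?w (P\<times>J) = (\<Sum>i\<in>P. \<Sum>j\<in>J. \<nu> i * fst i / n)"
          by (rule sum.cartesian_product[symmetric])
        also have "\<dots> = (\<Sum>i\<in>P. \<nu> i * fst i)" using n by (simp add: n_def)
        finally show "sum ?w (P\<times>J) = 1" using one by simp
        show "?z k \<in> convex hull ?S" if k: "k \<in> P \<times> J" for k
        proof -
          obtain i j where ij: "k = (i, j)" "i \<in> P" "j \<in> J" using k by auto
          have "?a i \<in> fin_points I" using ij by (auto simp: P_def fin_points_def)
          moreover have "(n * \<nu> j) *\<^sub>R snd j \<in> ray (dir_points I)"
          proof -
            have "snd j \<in> dir_points I" "0 \<le> n * \<nu> j"
              using ij \<nu>(1) n by (auto simp: J_def dir_points_def)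
            thus ?thesis unfolding ray_def by blast
          qed
          ultimately have "?a i + (n * \<nu> j) *\<^sub>R snd j \<in> ?S" by blast
          thus ?thesis unfolding ij by (simp add: hull_inc)
        qed
      qed (use IJ w0 n in auto)
      also have "(\<Sum>k\<in>P\<times>J. ?w k *\<^sub>R ?z k) = (\<Sum>i\<in>P. \<Sum>j\<in>J. (\<nu> i * fst i / n) *\<^sub>R (?a i + (n * \<nu> j) *\<^sub>R snd j))"
        by (simp add: sum.cartesian_product case_prod_beta)
      also have "\<dots> = (\<Sum>i\<in>P. (\<nu> i * fst i) *\<^sub>R ?a i + (\<nu> i * fst i) *\<^sub>R (\<Sum>j\<in>J. \<nu> j *\<^sub>R snd j))"
      proof (rule sum.cong[OF refl])
        fix i
        have "(\<Sum>j\<in>J. (\<nu> i * fst i / n) *\<^sub>R (?a i + (n * \<nu> j) *\<^sub>R snd j))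
            = (\<Sum>j\<in>J. (\<nu> i * fst i / n) *\<^sub>R ?a i) + (\<Sum>j\<in>J. (\<nu> i * fst i) *\<^sub>R (\<nu> j *\<^sub>R snd j))"
          using n by (simp add: scaleR_add_right sum.distrib mult.assoc)
        also have "(\<Sum>j\<in>J. (\<nu> i * fst i / n) *\<^sub>R ?a i) = (\<nu> i * fst i) *\<^sub>R ?a i"
          using n by (simp only: sum_constant_scaleR n_def[symmetric] scaleR_scaleR) simp
        finally show "(\<Sum>j\<in>J. (\<nu> i * fst i / n) *\<^sub>R (?a i + (n * \<nu> j) *\<^sub>R snd j))
            = (\<nu> i * fst i) *\<^sub>R ?a i + (\<nu> i * fst i) *\<^sub>R (\<Sum>j\<in>J. \<nu> j *\<^sub>R snd j)"
          by (simp only: scaleR_sum_right)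
      qed
      also have "\<dots> = y"
        by (simp only: sum.distrib scaleR_sum_left[symmetric] one y scaleR_one)
      finally show ?thesis .
    qed
    thus "y \<in> gen_conv (fin_points I) (dir_points I)" by (simp add: gen_conv_def)
  qed
qed

text \<open>
  Affine relations among points are the linear relations among their lifts.
\<close>
lemma dim_lift_eq_aff_dim:
  fixes S :: "'a::euclidean_space set"
  shows "int (dim (Pair (1::real) ` S)) = aff_dim S + 1"
proof -
  obtain B where B: "B \<subseteq> S" "\<not> affine_dependent B" "affine hull S = affine hull B"
    using affine_basis_exists by blast
  have fB: "finite B" using B aff_independent_finite by blast
  let ?L = "Pair (1::real)"
  have inj: "inj_on ?L B" by (simp add: inj_on_def)
  have "independent (?L ` B)"
  proof (rule ccontr)
    assume "\<not> independent (?L ` B)"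
    then obtain u where u: "\<exists>v\<in>?L ` B. u v \<noteq> 0" "(\<Sum>v\<in>?L ` B. u v *\<^sub>R v) = 0"
      using fB by (auto simp: dependent_finite)
    have "(\<Sum>b\<in>B. u (1, b) *\<^sub>R (1::real, b)) = 0"
      using u(2) by (simp add: sum.reindex[OF inj])
    hence "(\<Sum>b\<in>B. u (1, b)) = 0 \<and> (\<Sum>b\<in>B. u (1, b) *\<^sub>R b) = 0"
      by (simp add: prod_eq_iff fst_sum snd_sum)
    with u(1) have "affine_dependent B"
      using fB by (subst affine_dependent_explicit_finite) auto
    thus False using B by simp
  qed
  moreover have "?L ` S \<subseteq> span (?L ` B)"
  proof clarify
    fix s assume "s \<in> S"
    hence "s \<in> affine hull B" using B hull_inc by metis
    then obtain u where u: "sum u B = 1" "(\<Sum>v\<in>B. u v *\<^sub>R v) = s"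
      using fB by (auto simp: affine_hull_finite)
    have "(1, s) = (\<Sum>b\<in>B. u b *\<^sub>R ?L b)"
      using u by (simp add: prod_eq_iff fst_sum snd_sum)
    also have "\<dots> \<in> span (?L ` B)" by (intro span_sum span_scale span_base) auto
    finally show "(1, s) \<in> span (?L ` B)" .
  qed
  ultimately have "dim (?L ` S) = card (?L ` B)"
    using B by (intro dim_unique[of "?L ` B"]) auto
  also have "\<dots> = card B" by (rule card_image[OF inj])
  finally show ?thesis
    using aff_dim_affine_independent[OF B(2)] arg_cong[OF B(3), of aff_dim] by simp
qed

text \<open>
  The lifts of the generating set span the same linear space as the homogeneous generators:
  a direction is the difference of two lifted points.
\<close>
lemma aff_dim_gen_aff_lift:
  fixes I :: "(real \<times> 'a::euclidean_space) set"
  assumes ind: "independent I" and nonneg: "\<And>i. i \<in> I \<Longrightarrow> 0 \<le> fst i"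
    and i0: "i0 \<in> I" "0 < fst i0"
  shows "aff_dim (gen_aff (fin_points I) (dir_points I)) = int (card I) - 1"
proof -
  let ?S = "{v + r |v r. v \<in> fin_points I \<and> r \<in> ray (dir_points I)}"
  let ?L = "Pair (1::real)"
  have L: "?L ` ?S \<subseteq> span I"
  proof clarify
    fix v r assume "v \<in> fin_points I" and r: "r \<in> ray (dir_points I)"
    then obtain i where i: "i \<in> I" "0 < fst i" "v = snd i /\<^sub>R fst i"
      by (auto simp: fin_points_def)
    have "(1, v) = inverse (fst i) *\<^sub>R i" using i by (simp add: prod_eq_iff)
    hence v: "(1, v) \<in> span I" using i by (simp add: span_base span_scale)
    have "(0, r) \<in> span I"
    proof (cases "r = 0")
      case True
      have "(0::real, 0::'a) = 0" by (simp add: prod_eq_iff)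
      thus ?thesis using True by (simp add: span_zero)
    next
      case False
      then obtain j \<alpha> where j: "j \<in> I" "fst j = 0" "r = \<alpha> *\<^sub>R snd j"
        using r by (auto simp: ray_def dir_points_def)
      have "(0, r) = \<alpha> *\<^sub>R j" using j by (simp add: prod_eq_iff)
      thus ?thesis using j by (simp add: span_base span_scale)
    qed
    from span_add[OF v this] show "(1, v + r) \<in> span I" by simp
  qed
  have v_in: "(1, snd i /\<^sub>R fst i) \<in> ?L ` ?S" if "i \<in> I" "0 < fst i" for i
  proof (rule imageI)
    have "snd i /\<^sub>R fst i \<in> fin_points I"
      unfolding fin_points_def using that by (intro imageI) simp
    moreover have "0 \<in> ray (dir_points I)" by (simp add: ray_def)
    moreover have "snd i /\<^sub>R fst i = snd i /\<^sub>R fst i + 0" by simp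
    ultimately show "snd i /\<^sub>R fst i \<in> ?S" by blast
  qed
  have "I \<subseteq> span (?L ` ?S)"
  proof
    fix i assume i: "i \<in> I"
    show "i \<in> span (?L ` ?S)"
    proof (cases "0 < fst i")
      case True
      have "fst i *\<^sub>R (1, snd i /\<^sub>R fst i) = i" using True by (simp add: prod_eq_iff)
      thus ?thesis using span_scale[OF span_base[OF v_in[OF i True]], of "fst i"] by simp
    next
      case False
      hence f0: "fst i = 0" using nonneg[OF i] by simp
      let ?a = "snd i0 /\<^sub>R fst i0"
      have "?a \<in> fin_points I" unfolding fin_points_def using i0 by (intro imageI) simp
      moreover have "snd i \<in> ray (dir_points I)"
      proof -
        have "snd i \<in> dir_points I" unfolding dir_points_def using i f0 by (intro imageI) simp
        moreover have "snd i = 1 *\<^sub>R snd i" by simp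
        ultimately show ?thesis unfolding ray_def using zero_le_one by blast
      qed
      ultimately have "?a + snd i \<in> ?S" by blast
      hence "(1, ?a + snd i) \<in> span (?L ` ?S)" by (intro span_base imageI)
      moreover have "(1, ?a) \<in> span (?L ` ?S)" by (intro span_base v_in i0)
      ultimately have "(1, ?a + snd i) - (1, ?a) \<in> span (?L ` ?S)" by (rule span_diff)
      also have "(1, ?a + snd i) - (1, ?a) = i" using f0 by (simp add: prod_eq_iff)
      finally show ?thesis .
    qed
  qed
  hence "span (?L ` ?S) = span I" using L by (simp add: span_eq)
  hence "dim (?L ` ?S) = dim I" using dim_span[of "?L ` ?S"] dim_span[of I] by simp
  hence "dim (?L ` ?S) = card I" using ind by (simp add: dim_eq_card_independent)
  moreover have "aff_dim ?S = aff_dim (gen_aff (fin_points I) (dir_points I))"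
    by (simp add: gen_aff_def)
  ultimately show ?thesis using dim_lift_eq_aff_dim[of ?S] by simp
qed

lemma card_fin_dir_points:
  fixes I :: "(real \<times> 'a::euclidean_space) set"
  assumes fin: "finite I" and sph: "I \<subseteq> sphere 0 1" and nonneg: "\<And>i. i \<in> I \<Longrightarrow> 0 \<le> fst i"
  shows "card (fin_points I) + card (dir_points I) = card I"
proof -
  have "inj_on (\<lambda>i. snd i /\<^sub>R fst i) {i \<in> I. 0 < fst i}"
  proof (rule inj_onI)
    fix i j assume "i \<in> {i \<in> I. 0 < fst i}" "j \<in> {i \<in> I. 0 < fst i}"
      and eq: "snd i /\<^sub>R fst i = snd j /\<^sub>R fst j"
    hence i: "i \<in> I" "0 < fst i" and j: "j \<in> I" "0 < fst j" by auto
    have ni: "norm i = 1" "norm j = 1" using sph i j by auto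
    define r where "r = fst i / fst j"
    have r: "r > 0" using i j by (simp add: r_def)
    have "snd i = fst i *\<^sub>R (snd i /\<^sub>R fst i)" using i by simp
    also have "\<dots> = fst i *\<^sub>R (snd j /\<^sub>R fst j)" by (simp only: eq)
    also have "\<dots> = r *\<^sub>R snd j" by (simp add: r_def divide_inverse)
    finally have ij: "i = r *\<^sub>R j" using j by (simp add: prod_eq_iff r_def)
    have "norm (r *\<^sub>R j) = 1" using ni(1) by (simp only: ij[symmetric])
    hence "r = 1" using ni r by simp
    thus "i = j" using ij by simp
  qed
  hence 1: "card (fin_points I) = card {i \<in> I. 0 < fst i}"
    unfolding fin_points_def by (rule card_image)
  have "inj_on snd {i \<in> I. fst i = 0}" by (auto simp: inj_on_def prod_eq_iff)
  hence 2: "card (dir_points I) = card {i \<in> I. fst i = 0}"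
    unfolding dir_points_def by (rule card_image)
  have "I = {i \<in> I. 0 < fst i} \<union> {i \<in> I. fst i = 0}" using nonneg by force
  moreover have "card ({i \<in> I. 0 < fst i} \<union> {i \<in> I. fst i = 0}) = card {i \<in> I. 0 < fst i} + card {i \<in> I. fst i = 0}"
    using fin by (intro card_Un_disjoint) auto
  ultimately show ?thesis using 1 2 by simp
qed

lemma gen_simplex_lift:
  fixes I :: "(real \<times> 'a::euclidean_space) set"
  assumes fin: "finite I" and sph: "I \<subseteq> sphere 0 1" and nonneg: "\<And>i. i \<in> I \<Longrightarrow> 0 \<le> fst i"
    and ind: "independent I" and i0: "i0 \<in> I" "0 < fst i0"
  shows "gen_simplex (gen_conv (fin_points I) (dir_points I)) (fin_points I) (dir_points I)"
proof -
  have "snd i0 /\<^sub>R fst i0 \<in> fin_points I"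
    unfolding fin_points_def using i0 by (intro imageI) simp
  hence "fin_points I \<noteq> {}" by blast
  moreover have "dir_points I \<subseteq> sphere 0 1"
    using sph by (auto simp: dir_points_def norm_prod_def)
  moreover have "finite (fin_points I)" "finite (dir_points I)"
    using fin by (auto simp: fin_points_def dir_points_def)
  ultimately show ?thesis
    using aff_dim_gen_aff_lift[of I i0] card_fin_dir_points[of I] assms
    unfolding gen_simplex_def gen_affinely_independent_def by auto
qed

text \<open>
  With all weights positive, a segment from any point of the hull to \<open>x\<close> can be prolonged
  beyond \<open>x\<close> without a weight becoming negative.
\<close>
lemma rel_interior_gen_conv_lift:
  fixes I :: "(real \<times> 'a::euclidean_space) set"
  assumes fin: "finite I" and nonneg: "\<And>i. i \<in> I \<Longrightarrow> 0 \<le> fst i"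
    and pos: "\<And>i. i \<in> I \<Longrightarrow> 0 < c i" and x: "(\<Sum>i\<in>I. c i *\<^sub>R i) = (1, x)"
  shows "x \<in> rel_interior (gen_conv (fin_points I) (dir_points I))"
proof -
  let ?C = "gen_conv (fin_points I) (dir_points I)"
  have C: "?C = {y. \<exists>\<nu>. (\<forall>i\<in>I. 0 \<le> \<nu> i) \<and> (\<Sum>i\<in>I. \<nu> i *\<^sub>R i) = (1, y)}"
    by (rule gen_conv_lift[OF fin nonneg])
  have xC: "x \<in> ?C"
    unfolding C using pos x by (intro CollectI exI[of _ c]) (simp add: less_imp_le)
  have cv: "convex ?C" by (simp add: gen_conv_def)
  have "\<exists>e>1. (1 - e) *\<^sub>R y + e *\<^sub>R x \<in> ?C" if "y \<in> ?C" for y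
  proof -
    from that obtain \<nu> where \<nu>: "\<forall>i\<in>I. 0 \<le> \<nu> i" "(\<Sum>i\<in>I. \<nu> i *\<^sub>R i) = (1, y)"
      unfolding C by auto
    have "\<forall>\<^sub>F \<epsilon> in at_right 0. \<forall>i\<in>I. 0 < c i + \<epsilon> * (c i - \<nu> i)"
    proof (rule eventually_ball_finite[OF fin], rule ballI)
      fix i assume "i \<in> I"
      have "((\<lambda>\<epsilon>. c i + \<epsilon> * (c i - \<nu> i)) \<longlongrightarrow> c i + 0 * (c i - \<nu> i)) (at_right 0)"
        by (intro tendsto_intros)
      thus "\<forall>\<^sub>F \<epsilon> in at_right 0. 0 < c i + \<epsilon> * (c i - \<nu> i)"
        using pos[OF \<open>i \<in> I\<close>] by (intro order_tendstoD(1)) auto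
    qed
    moreover have "\<forall>\<^sub>F \<epsilon> in at_right 0. (0::real) < \<epsilon>" by (rule eventually_at_right_less)
    ultimately have "\<forall>\<^sub>F \<epsilon> in at_right 0. 0 < \<epsilon> \<and> (\<forall>i\<in>I. 0 < c i + \<epsilon> * (c i - \<nu> i))"
      by eventually_elim auto
    from eventually_happens'[OF trivial_limit_at_right_real this]
    obtain \<epsilon> where \<epsilon>: "0 < \<epsilon>" "\<forall>i\<in>I. 0 < c i + \<epsilon> * (c i - \<nu> i)" by blast
    have "(\<Sum>i\<in>I. (c i + \<epsilon> * (c i - \<nu> i)) *\<^sub>R i)
        = (\<Sum>i\<in>I. c i *\<^sub>R i) + \<epsilon> *\<^sub>R ((\<Sum>i\<in>I. c i *\<^sub>R i) - (\<Sum>i\<in>I. \<nu> i *\<^sub>R i))"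
      unfolding sum_subtractf[symmetric] scaleR_sum_right sum.distrib[symmetric]
      by (rule sum.cong[OF refl])
        (simp add: scaleR_add_left scaleR_diff_left scaleR_diff_right right_diff_distrib)
    also have "\<dots> = (1, (1 - (1 + \<epsilon>)) *\<^sub>R y + (1 + \<epsilon>) *\<^sub>R x)"
      using x \<nu> by (simp add: prod_eq_iff scaleR_add_left scaleR_diff_right)
    finally have "(1 - (1 + \<epsilon>)) *\<^sub>R y + (1 + \<epsilon>) *\<^sub>R x \<in> ?C"
      unfolding C using \<epsilon>(2)
      by (intro CollectI exI[of _ "\<lambda>i. c i + \<epsilon> * (c i - \<nu> i)"]) (simp add: less_imp_le)
    thus ?thesis using \<epsilon> by (intro exI[of _ "1 + \<epsilon>"]) auto
  qed
  thus ?thesis using convex_rel_interior_iff[OF cv] xC by blast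
qed

section \<open>Relatively closed, locally convex sets without extreme points\<close>

text \<open>
  These are the only properties of an extremal set that the geometric argument uses.  In particular,
  \<open>G\<close> is neither connected nor convex in general, and convexity of \<open>E\<close> is available only along
  segments that stay in \<open>G\<close>.
\<close>
locale extreme_point_free =
  fixes G E :: "'a::euclidean_space set"
  assumes open_G: "open G"
    and E_subset: "E \<subseteq> G"
    and closed_in_G: "closure E \<inter> G \<subseteq> E"
    and segment_in_E: "\<lbrakk>y \<in> E; z \<in> E; closed_segment y z \<subseteq> G\<rbrakk> \<Longrightarrow> closed_segment y z \<subseteq> E"
    and not_extreme: "y \<in> E \<Longrightarrow> \<exists>u. u \<noteq> 0 \<and> closed_segment (y - u) (y + u) \<subseteq> E"
begin

lemma frontier_not_E: "q \<in> frontier G \<Longrightarrow> q \<notin> E"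
  using E_subset open_G by (auto simp: frontier_def interior_open)

lemma closure_E_cases: "y \<in> closure E \<Longrightarrow> y \<notin> frontier G \<Longrightarrow> y \<in> E"
  using closure_mono[OF E_subset] closed_in_G open_G by (auto simp: frontier_def interior_open)

text \<open>
  The hull is blown up from \<open>x\<close> until it first meets the frontier of \<open>G\<close>.  Before that
  happens, each intermediate hull is a compact convex subset of \<open>G\<close>, and a slightly larger one is
  still inside \<open>G\<close>; its generators lie in \<open>E\<close>, so all of it does.  At the moment
  of contact the hull lies in the closure of \<open>E\<close>, which makes the frontier point visible from \<open>x\<close>.
\<close>
lemma sweep:
  assumes x: "x \<in> E" and A: "compact A" and vis: "\<And>a. a \<in> A \<Longrightarrow> closed_segment x a \<subseteq> closure E"
  shows "convex hull (insert x A) \<subseteq> closure E \<or>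
    (\<exists>t p. 0 \<le> t \<and> t < 1 \<and> p \<in> convex hull (insert x A) \<and> x + t *\<^sub>R (p - x) \<in> frontier G \<and>
       closed_segment x (x + t *\<^sub>R (p - x)) \<subseteq> closure E)"
proof (rule disjCI)
  let ?P = "convex hull (insert x A)"
  let ?h = "\<lambda>t p. x + t *\<^sub>R (p - x)"
  assume none: "\<nexists>t p. 0 \<le> t \<and> t < 1 \<and> p \<in> ?P \<and> ?h t p \<in> frontier G \<and>
       closed_segment x (?h t p) \<subseteq> closure E"
  have P: "compact ?P" "x \<in> ?P" using A by (auto intro: compact_convex_hull hull_inc)
  define S where "S = {t. 0 \<le> t \<and> t \<le> 1 \<and> (\<forall>p\<in>?P. ?h t p \<in> closure E)}"
  have "closed S"
  proof -
    have "S = {0..1} \<inter> (\<Inter>p\<in>?P. (\<lambda>t. ?h t p) -` closure E)" by (auto simp: S_def)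
    moreover have "closed ((\<lambda>t. ?h t p) -` closure E)" for p
      by (intro continuous_closed_vimage closed_closure) (auto intro!: continuous_intros)
    ultimately show ?thesis by auto
  qed
  moreover have "bounded S" by (rule bounded_subset[of "{0..1}"]) (auto simp: S_def)
  ultimately have "compact S" by (simp add: compact_eq_bounded_closed)
  moreover have "0 \<in> S" using x closure_subset by (auto simp: S_def)
  ultimately obtain m where m: "m \<in> S" "\<And>t. t \<in> S \<Longrightarrow> t \<le> m"
    using compact_attains_sup[of S] by blast
  have "m = 1"
  proof (rule ccontr)
    assume "m \<noteq> 1"
    hence m1: "0 \<le> m" "m < 1" using m by (auto simp: S_def)
    have seg: "closed_segment x (?h m p) \<subseteq> closure E" if p: "p \<in> ?P" for p
    proof
      fix y assume "y \<in> closed_segment x (?h m p)"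
      then obtain u where u: "0 \<le> u" "u \<le> 1" "y = (1 - u) *\<^sub>R x + u *\<^sub>R ?h m p"
        by (auto simp: closed_segment_def)
      have "y = ?h m ((1 - u) *\<^sub>R x + u *\<^sub>R p)" by (simp add: u algebra_simps)
      moreover have "(1 - u) *\<^sub>R x + u *\<^sub>R p \<in> ?P"
        using u P p by (intro convexD_alt) auto
      ultimately show "y \<in> closure E" using m by (auto simp: S_def)
    qed
    have inE: "?h m p \<in> E" if "p \<in> ?P" for p
    proof (rule closure_E_cases)
      show "?h m p \<in> closure E" using m that by (auto simp: S_def)
      show "?h m p \<notin> frontier G" using none seg[OF that] m1 that by blast
    qed
    have "compact (?h m ` ?P)"
      by (intro compact_continuous_image P) (auto intro!: continuous_intros)
    moreover have "?h m ` ?P \<subseteq> G" using inE E_subset by auto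
    ultimately obtain \<epsilon> where \<epsilon>: "\<epsilon> > 0" "(\<Union>y\<in>?h m ` ?P. ball y \<epsilon>) \<subseteq> G"
      using compact_subset_open_imp_ball_epsilon_subset[OF _ open_G] by blast
    obtain M where M: "M > 0" "\<And>p. p \<in> ?P \<Longrightarrow> norm (p - x) \<le> M"
    proof -
      have "bounded ((\<lambda>p. p - x) ` ?P)"
        by (intro compact_imp_bounded compact_continuous_image P) (auto intro!: continuous_intros)
      then obtain M where "M > 0" "\<forall>y\<in>(\<lambda>p. p - x) ` ?P. norm y \<le> M"
        by (auto simp: bounded_pos)
      thus ?thesis using that by auto
    qed
    define t where "t = min 1 (m + \<epsilon> / (2 * M))"
    have t: "m < t" "t \<le> 1" "t - m \<le> \<epsilon> / (2 * M)" using m1 \<epsilon> M by (auto simp: t_def)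
    have tG: "?h t p \<in> G" if p: "p \<in> ?P" for p
    proof -
      have "dist (?h m p) (?h t p) = norm ((t - m) *\<^sub>R (p - x))"
        by (simp add: dist_norm norm_minus_commute algebra_simps)
      also have "\<dots> = (t - m) * norm (p - x)" using t by simp
      also have "\<dots> \<le> \<epsilon> / (2 * M) * M"
        using t M p by (intro mult_mono) auto
      also have "\<dots> < \<epsilon>" using M \<epsilon> by simp
      finally have "?h t p \<in> ball (?h m p) \<epsilon>" by simp
      thus ?thesis using \<epsilon> p by blast
    qed
    \<comment> \<open>convexity of this set replaces a description of the blown-up hull by its generators\<close>
    define Q where "Q = {p \<in> ?P. ?h t p \<in> E}"
    have "convex Q"
    proof (rule convexI)
      fix p q and u v :: real
      assume pq: "p \<in> Q" "q \<in> Q" and uv: "0 \<le> u" "0 \<le> v" "u + v = 1"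
      have aff: "?h t ((1 - w) *\<^sub>R p + w *\<^sub>R q) = (1 - w) *\<^sub>R ?h t p + w *\<^sub>R ?h t q" for w
        by (simp add: algebra_simps)
      have inP: "(1 - w) *\<^sub>R p + w *\<^sub>R q \<in> ?P" if "0 \<le> w" "w \<le> 1" for w
        using pq that by (intro convexD_alt) (auto simp: Q_def)
      have "closed_segment (?h t p) (?h t q) \<subseteq> G"
      proof
        fix y assume "y \<in> closed_segment (?h t p) (?h t q)"
        then obtain w where w: "0 \<le> w" "w \<le> 1" "y = (1 - w) *\<^sub>R ?h t p + w *\<^sub>R ?h t q"
          by (auto simp: closed_segment_def)
        show "y \<in> G" using tG[OF inP[OF w(1,2)]] unfolding aff w(3) .
      qed
      hence sE: "closed_segment (?h t p) (?h t q) \<subseteq> E"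
        using pq by (intro segment_in_E) (auto simp: Q_def)
      have u: "u = 1 - v" "v \<le> 1" using uv by auto
      have "?h t ((1 - v) *\<^sub>R p + v *\<^sub>R q) \<in> E"
        unfolding aff using sE uv u by (auto simp: closed_segment_def)
      thus "u *\<^sub>R p + v *\<^sub>R q \<in> Q" unfolding u(1) Q_def using inP[of v] uv u by auto
    qed
    moreover have "insert x A \<subseteq> Q"
    proof -
      have "?h t a \<in> E" if a: "a \<in> A" for a
      proof -
        have "?h t a \<in> closed_segment x a"
          using t m1 by (auto simp: closed_segment_def algebra_simps intro!: exI[of _ t])
        moreover have "?h t a \<in> G" using tG a by (simp add: hull_inc)
        ultimately show ?thesis using vis[OF a] closed_in_G by blast
      qed
      thus ?thesis using x by (auto simp: Q_def hull_inc)
    qed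
    ultimately have "?P \<subseteq> Q" by (intro hull_minimal)
    hence "t \<in> S" using t m1 closure_subset by (auto simp: S_def Q_def)
    thus False using m(2)[of t] t by simp
  qed
  thus "?P \<subseteq> closure E" using m by (auto simp: S_def)
qed

text \<open>
  For \<open>p = (s, y)\<close> with \<open>s > 0\<close> and \<open>a = y / s\<close>, the points \<open>x + \<sigma> (y - s x)\<close> with \<open>\<sigma> s < 1\<close> are the half-open segment
  from \<open>x\<close> to \<open>a\<close>; for \<open>s = 0\<close> they are the ray from \<open>x\<close> in direction \<open>y\<close>.
  One formula thus covers visible frontier points and visible directions, and frontier points
  that escape to infinity converge to directions.  The strict bound on \<open>\<sigma> s\<close> is stable
  under such limits and loses nothing, as the closure supplies the endpoint.
\<close>
definition horizon :: "'a \<Rightarrow> (real \<times> 'a) set" where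
  "horizon x = {p. norm p = 1 \<and> 0 \<le> fst p \<and>
     (\<forall>\<sigma>\<ge>0. \<sigma> * fst p < 1 \<longrightarrow> x + \<sigma> *\<^sub>R (snd p - fst p *\<^sub>R x) \<in> closure E) \<and>
     (0 < fst p \<longrightarrow> snd p /\<^sub>R fst p \<in> frontier G)}"

lemma horizon_sphere: "horizon x \<subseteq> sphere 0 1"
  by (auto simp: horizon_def)

lemma horizon_fst: "p \<in> horizon x \<Longrightarrow> 0 \<le> fst p"
  by (auto simp: horizon_def)

lemma compact_horizon: "compact (horizon x)"
proof -
  have "closed (horizon x)"
    unfolding closed_sequential_limits
  proof clarify
    fix X :: "nat \<Rightarrow> real \<times> 'a" and s y
    assume X: "\<forall>n. X n \<in> horizon x" and lim: "X \<longlonglongrightarrow> (s, y)"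
    have ls: "(\<lambda>n. fst (X n)) \<longlonglongrightarrow> s" and ly: "(\<lambda>n. snd (X n)) \<longlonglongrightarrow> y"
      using tendsto_fst[OF lim] tendsto_snd[OF lim] by auto
    have "(\<lambda>n. norm (X n)) \<longlonglongrightarrow> norm (s, y)" by (intro tendsto_norm lim)
    moreover have "(\<lambda>n. norm (X n)) = (\<lambda>n. 1)" using X by (auto simp: horizon_def)
    ultimately have 1: "norm (s, y) = 1" using LIMSEQ_unique tendsto_const by metis
    have 2: "0 \<le> s" using ls X by (intro LIMSEQ_le_const) (auto simp: horizon_def)
    have 3: "x + \<sigma> *\<^sub>R (y - s *\<^sub>R x) \<in> closure E" if \<sigma>: "0 \<le> \<sigma>" "\<sigma> * s < 1" for \<sigma>
    proof (rule Lim_in_closed_set[OF closed_closure _ sequentially_bot])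
      have "(\<lambda>n. \<sigma> * fst (X n)) \<longlonglongrightarrow> \<sigma> * s" by (intro tendsto_intros ls)
      hence "\<forall>\<^sub>F n in sequentially. \<sigma> * fst (X n) < 1" using \<sigma> order_tendstoD(2) by blast
      thus "\<forall>\<^sub>F n in sequentially. x + \<sigma> *\<^sub>R (snd (X n) - fst (X n) *\<^sub>R x) \<in> closure E"
        by eventually_elim (use X \<sigma> in \<open>auto simp: horizon_def\<close>)
      show "(\<lambda>n. x + \<sigma> *\<^sub>R (snd (X n) - fst (X n) *\<^sub>R x)) \<longlonglongrightarrow> x + \<sigma> *\<^sub>R (y - s *\<^sub>R x)"
        by (intro tendsto_intros ls ly)
    qed
    have 4: "y /\<^sub>R s \<in> frontier G" if "0 < s"
    proof (rule Lim_in_closed_set[OF frontier_closed _ sequentially_bot])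
      have "\<forall>\<^sub>F n in sequentially. 0 < fst (X n)" using ls that order_tendstoD(1) by blast
      thus "\<forall>\<^sub>F n in sequentially. snd (X n) /\<^sub>R fst (X n) \<in> frontier G"
        by eventually_elim (use X in \<open>auto simp: horizon_def\<close>)
      show "(\<lambda>n. snd (X n) /\<^sub>R fst (X n)) \<longlonglongrightarrow> y /\<^sub>R s"
        using that by (intro tendsto_intros ls ly) auto
    qed
    show "(s, y) \<in> horizon x" using 1 2 3 4 by (simp add: horizon_def)
  qed
  moreover have "bounded (horizon x)"
    using bounded_subset[OF bounded_sphere horizon_sphere] .
  ultimately show ?thesis by (simp add: compact_eq_bounded_closed)
qed

lemma horizon_pointI:
  assumes a: "a \<in> frontier G" "closed_segment x a \<subseteq> closure E"
  shows "(1, a) /\<^sub>R norm (1::real, a) \<in> horizon x"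
proof -
  define n where "n = norm (1::real, a)"
  have n: "n > 0" by (simp add: n_def zero_prod_def)
  have eq: "(1::real, a) /\<^sub>R n = (inverse n, a /\<^sub>R n)" by simp
  have "x + \<sigma> *\<^sub>R (a /\<^sub>R n - inverse n *\<^sub>R x) \<in> closure E" if "0 \<le> \<sigma>" "\<sigma> * inverse n < 1" for \<sigma>
  proof -
    have "x + \<sigma> *\<^sub>R (a /\<^sub>R n - inverse n *\<^sub>R x) = (1 - \<sigma> * inverse n) *\<^sub>R x + (\<sigma> * inverse n) *\<^sub>R a"
      by (simp add: algebra_simps)
    also have "\<dots> \<in> closed_segment x a"
      unfolding closed_segment_def using that n
      by (intro CollectI exI[of _ "\<sigma> * inverse n"]) auto
    finally show ?thesis using a by blast
  qed
  moreover have "norm (inverse n, a /\<^sub>R n) = 1"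
  proof -
    have "norm ((1::real, a) /\<^sub>R n) = \<bar>inverse n\<bar> * n" by (simp only: norm_scaleR n_def)
    thus ?thesis unfolding eq using n by simp
  qed
  ultimately have "(inverse n, a /\<^sub>R n) \<in> horizon x"
    using n a by (auto simp: horizon_def)
  thus ?thesis unfolding n_def[symmetric] eq .
qed

lemma horizon_dirI:
  assumes "norm e = 1" "\<And>s. 0 \<le> s \<Longrightarrow> x + s *\<^sub>R e \<in> closure E"
  shows "(0, e) \<in> horizon x"
  using assms by (simp add: horizon_def norm_prod_def)

text \<open>
  The version of the sweep for generators at infinity.  A generator \<open>(s, y)\<close> is replaced by
  the point \<open>x + (y - s x) / (s + \<delta>)\<close>, which tends to the vertex or to infinity as \<open>\<delta>\<close> tends to zero
  and is visible for every \<open>\<delta> > 0\<close>.  The combination at which the sweep is blocked has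
  total first coordinate less than one; a positive multiple of \<open>(1, x)\<close> makes up the difference.
\<close>
lemma cone_sweep:
  assumes x: "x \<in> E" and I: "finite I" "I \<subseteq> horizon x"
    and none: "\<And>q \<nu>. \<lbrakk>q \<in> frontier G; closed_segment x q \<subseteq> closure E; \<And>i. i \<in> I \<Longrightarrow> 0 \<le> \<nu> i;
        (\<Sum>i\<in>I. \<nu> i * fst i) < 1; q = x + (\<Sum>i\<in>I. \<nu> i *\<^sub>R (snd i - fst i *\<^sub>R x))\<rbrakk> \<Longrightarrow> False"
    and \<nu>: "\<And>i. i \<in> I \<Longrightarrow> 0 \<le> \<nu> i" "(\<Sum>i\<in>I. \<nu> i * fst i) \<le> 1"
  shows "x + (\<Sum>i\<in>I. \<nu> i *\<^sub>R (snd i - fst i *\<^sub>R x)) \<in> closure E"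
proof -
  let ?w = "\<lambda>\<nu>. x + (\<Sum>i\<in>I. \<nu> i *\<^sub>R (snd i - fst i *\<^sub>R x))"
  have scale: "?w (\<lambda>i. t * \<mu> i) = x + t *\<^sub>R (?w \<mu> - x)" for t \<mu>
    by (simp add: scaleR_sum_right)
  have strict: "?w \<mu> \<in> closure E"
    if \<mu>: "\<And>i. i \<in> I \<Longrightarrow> 0 \<le> \<mu> i" "(\<Sum>i\<in>I. \<mu> i * fst i) < 1" for \<mu>
  proof -
    \<comment> \<open>small enough for the given combination to remain in the hull of the replaced generators\<close>
    define \<delta> where "\<delta> = (1 - (\<Sum>i\<in>I. \<mu> i * fst i)) / (sum \<mu> I + 1)"
    have s0: "0 \<le> sum \<mu> I" using \<mu> by (intro sum_nonneg) auto
    have \<delta>: "\<delta> > 0" using \<mu> s0 by (simp add: \<delta>_def)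
    have "\<delta> * sum \<mu> I \<le> \<delta> * (sum \<mu> I + 1)" using \<delta> by simp
    also have "\<dots> = 1 - (\<Sum>i\<in>I. \<mu> i * fst i)" using s0 by (simp add: \<delta>_def)
    finally have le1: "(\<Sum>i\<in>I. \<mu> i * (fst i + \<delta>)) \<le> 1"
      by (simp add: distrib_left sum.distrib sum_distrib_left mult.commute)
    have fp: "0 < fst i + \<delta>" if "i \<in> I" for i using horizon_fst I that \<delta> by (meson add_nonneg_pos subsetD)
    let ?g = "\<lambda>i. x + inverse (fst i + \<delta>) *\<^sub>R (snd i - fst i *\<^sub>R x)"
    have vis: "closed_segment x a \<subseteq> closure E" if a: "a \<in> ?g ` I" for a
    proof
      fix y assume y: "y \<in> closed_segment x a"
      obtain i where i: "i \<in> I" "a = ?g i" using a by auto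
      obtain u where u: "0 \<le> u" "u \<le> 1" "y = (1 - u) *\<^sub>R x + u *\<^sub>R a"
        using y by (auto simp: closed_segment_def)
      have "y = x + (u * inverse (fst i + \<delta>)) *\<^sub>R (snd i - fst i *\<^sub>R x)"
        unfolding u i by (simp add: algebra_simps)
      moreover have "u * inverse (fst i + \<delta>) * fst i < 1"
      proof -
        have "0 \<le> fst i" using horizon_fst I i by blast
        hence "u * (inverse (fst i + \<delta>) * fst i) \<le> 1 * (inverse (fst i + \<delta>) * fst i)"
          using u fp[OF i(1)] by (intro mult_right_mono mult_nonneg_nonneg) simp_all
        also have "\<dots> < 1" using fp[OF i(1)] \<delta> by (simp add: field_simps)
        finally show ?thesis by (simp add: mult.assoc)
      qed
      moreover have "0 \<le> u * inverse (fst i + \<delta>)" using u fp[OF i(1)] by simp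
      ultimately show "y \<in> closure E" using i I unfolding horizon_def by blast
    qed
    have cA: "compact (?g ` I)" using I by (simp add: finite_imp_compact)
    let ?P = "convex hull (insert x (?g ` I))"
    let ?Q = "{y. \<exists>\<beta>. (\<forall>i\<in>I. 0 \<le> \<beta> i) \<and> (\<Sum>i\<in>I. \<beta> i * (fst i + \<delta>)) \<le> 1 \<and> y = ?w \<beta>}"
    have PQ: "?P \<subseteq> ?Q"
    proof (rule hull_minimal)
      have "x \<in> ?Q" by (intro CollectI exI[of _ "\<lambda>_. 0"]) simp
      moreover have "?g i \<in> ?Q" if i: "i \<in> I" for i
      proof -
        let ?\<beta> = "\<lambda>k. if k = i then inverse (fst i + \<delta>) else 0"
        have "(\<Sum>k\<in>I. ?\<beta> k *\<^sub>R (fst k + \<delta>)) = inverse (fst i + \<delta>) *\<^sub>R (fst i + \<delta>)"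
          by (rule sum_delta_scaleR[OF I(1) i])
        moreover have "?w ?\<beta> = ?g i" using sum_delta_scaleR[OF I(1) i] by simp
        ultimately show ?thesis
          using fp[OF i] by (intro CollectI exI[of _ ?\<beta>]) auto
      qed
      ultimately show "insert x (?g ` I) \<subseteq> ?Q" by blast
      show "convex ?Q"
      proof (rule convexI)
        fix p q and u v :: real
        assume "p \<in> ?Q" "q \<in> ?Q" and uv: "0 \<le> u" "0 \<le> v" "u + v = 1"
        then obtain \<beta> \<gamma> where b: "\<forall>i\<in>I. 0 \<le> \<beta> i" "(\<Sum>i\<in>I. \<beta> i * (fst i + \<delta>)) \<le> 1" "p = ?w \<beta>"
          and g: "\<forall>i\<in>I. 0 \<le> \<gamma> i" "(\<Sum>i\<in>I. \<gamma> i * (fst i + \<delta>)) \<le> 1" "q = ?w \<gamma>" by auto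
        let ?\<eta> = "\<lambda>i. u * \<beta> i + v * \<gamma> i"
        have "(\<Sum>i\<in>I. ?\<eta> i * (fst i + \<delta>))
            = u * (\<Sum>i\<in>I. \<beta> i * (fst i + \<delta>)) + v * (\<Sum>i\<in>I. \<gamma> i * (fst i + \<delta>))"
          by (simp add: distrib_right sum.distrib sum_distrib_left mult.assoc)
        also have "\<dots> \<le> u * 1 + v * 1" using b g uv by (intro add_mono mult_left_mono) auto
        finally have "(\<Sum>i\<in>I. ?\<eta> i * (fst i + \<delta>)) \<le> 1" using uv by simp
        moreover have "u *\<^sub>R p + v *\<^sub>R q = ?w ?\<eta>"
        proof -
          have "u *\<^sub>R x + v *\<^sub>R x = x" using uv by (simp add: scaleR_add_left[symmetric])
          thus ?thesis unfolding b g
            by (simp add: scaleR_add_right scaleR_add_left[of _ _ "_ - _"] sum.distrib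
                scaleR_sum_right[of u] scaleR_sum_right[of v] add_ac)
        qed
        ultimately show "u *\<^sub>R p + v *\<^sub>R q \<in> ?Q"
          using b g uv by (intro CollectI exI[of _ ?\<eta>]) auto
      qed
    qed
    have wP: "?w \<mu> \<in> ?P"
    proof -
      let ?b = "\<lambda>i. \<mu> i * (fst i + \<delta>)"
      have "(\<Sum>i\<in>I. ?b i *\<^sub>R ?g i) + (1 - sum ?b I) *\<^sub>R x \<in> ?P"
        using I le1 \<mu> fp by (intro convex_sum_plus_one) (auto simp: hull_inc less_imp_le)
      also have "(\<Sum>i\<in>I. ?b i *\<^sub>R ?g i) = (\<Sum>i\<in>I. ?b i *\<^sub>R x + \<mu> i *\<^sub>R (snd i - fst i *\<^sub>R x))"
      proof (rule sum.cong[OF refl])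
        fix i assume "i \<in> I"
        thus "?b i *\<^sub>R ?g i = ?b i *\<^sub>R x + \<mu> i *\<^sub>R (snd i - fst i *\<^sub>R x)"
          using fp[of i] by (simp only: scaleR_add_right scaleR_scaleR) simp
      qed
      also have "\<dots> = sum ?b I *\<^sub>R x + (\<Sum>i\<in>I. \<mu> i *\<^sub>R (snd i - fst i *\<^sub>R x))"
        by (simp only: sum.distrib scaleR_sum_left)
      finally show ?thesis by (simp add: scaleR_diff_left add.commute)
    qed
    have "?P \<subseteq> closure E \<or> (\<exists>t p. 0 \<le> t \<and> t < 1 \<and> p \<in> ?P \<and>
        x + t *\<^sub>R (p - x) \<in> frontier G \<and> closed_segment x (x + t *\<^sub>R (p - x)) \<subseteq> closure E)"
      by (rule sweep[OF x cA]) (rule vis)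
    thus ?thesis
    proof (elim disjE exE conjE)
      assume "?P \<subseteq> closure E"
      thus ?thesis using wP by blast
    next
      fix t p
      assume t: "0 \<le> t" "t < 1" and p: "p \<in> ?P" and fr: "x + t *\<^sub>R (p - x) \<in> frontier G"
        and seg: "closed_segment x (x + t *\<^sub>R (p - x)) \<subseteq> closure E"
      obtain \<beta> where b: "\<forall>i\<in>I. 0 \<le> \<beta> i" "(\<Sum>i\<in>I. \<beta> i * (fst i + \<delta>)) \<le> 1" "p = ?w \<beta>"
        using p PQ by blast
      have eq: "x + t *\<^sub>R (p - x) = ?w (\<lambda>i. t * \<beta> i)" unfolding scale b by simp
      have "(\<Sum>i\<in>I. \<beta> i * fst i) \<le> (\<Sum>i\<in>I. \<beta> i * (fst i + \<delta>))"
        using b \<delta> by (intro sum_mono mult_left_mono) auto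
      hence "t * (\<Sum>i\<in>I. \<beta> i * fst i) \<le> t * 1" using b t by (intro mult_left_mono) auto
      hence "(\<Sum>i\<in>I. t * \<beta> i * fst i) < 1" using t by (simp add: sum_distrib_left mult.assoc)
      from none[OF fr seg _ this eq] b t show ?thesis by auto
    qed
  qed
  show ?thesis
  proof (rule Lim_in_closed_set[OF closed_closure _ sequentially_bot])
    let ?t = "\<lambda>n::nat. 1 - inverse (real (Suc n))"
    have "?t \<longlonglongrightarrow> 1 - 0" by (intro tendsto_intros LIMSEQ_inverse_real_of_nat)
    hence "(\<lambda>n. x + ?t n *\<^sub>R (?w \<nu> - x)) \<longlonglongrightarrow> x + 1 *\<^sub>R (?w \<nu> - x)"
      by (intro tendsto_intros) simp
    thus "(\<lambda>n. x + ?t n *\<^sub>R (?w \<nu> - x)) \<longlonglongrightarrow> ?w \<nu>" by simp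
    show "\<forall>\<^sub>F n in sequentially. x + ?t n *\<^sub>R (?w \<nu> - x) \<in> closure E"
    proof (rule always_eventually, rule allI)
      fix n
      have t: "0 \<le> ?t n" "?t n < 1" by (auto simp: field_simps)
      have "(\<Sum>i\<in>I. ?t n * \<nu> i * fst i) = ?t n * (\<Sum>i\<in>I. \<nu> i * fst i)"
        by (simp add: sum_distrib_left mult.assoc)
      also have "\<dots> \<le> ?t n * 1" using t \<nu> by (intro mult_left_mono) auto
      also have "\<dots> < 1" using t by simp
      finally have "(\<Sum>i\<in>I. ?t n * \<nu> i * fst i) < 1" .
      hence "?w (\<lambda>i. ?t n * \<nu> i) \<in> closure E" using \<nu> t by (intro strict) auto
      thus "x + ?t n *\<^sub>R (?w \<nu> - x) \<in> closure E" unfolding scale .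
    qed
  qed
qed

lemma visible_frontier_in_cone:
  assumes "q \<in> frontier G" "closed_segment x q \<subseteq> closure E"
  shows "(1, q) \<in> convex_cone hull (horizon x)"
  using convex_cone_hull_mul[OF hull_inc[OF horizon_pointI[OF assms]], of "norm (1::real, q)"]
  by (simp only: normalized_lift norm_ge_zero)

text \<open>
  For the representation of least weight, a visible frontier point can be a combination of
  the generators only if it is one of them.  A blocked sweep would give such a frontier point with
  all coefficients positive, since a positive multiple of \<open>(1, x)\<close> is part of the combination; then there
  would be a single generator and \<open>x\<close> itself would lie on the frontier.
\<close>
lemma simplex_if_balanced:
  assumes x: "x \<in> E" and bal: "(1, x) \<in> convex_cone hull (horizon x)"
  shows "\<exists>C V D. gen_simplex C V D \<and> x \<in> rel_interior C \<and> V \<subseteq> frontier G \<and>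
    C \<subseteq> closure E \<and> C - V \<subseteq> E \<and> card D \<le> 1"
proof -
  have nz: "(1, x) \<noteq> (0 :: real \<times> 'a)" by (simp add: zero_prod_def)
  obtain I c where I: "finite I" "I \<subseteq> horizon x" "independent I"
    and c: "\<And>i. i \<in> I \<Longrightarrow> 0 < c i" "(\<Sum>i\<in>I. c i *\<^sub>R i) = (1, x)"
    and opt: "\<And>k \<nu> \<rho> i. \<lbrakk>k \<in> horizon x; 0 \<le> \<rho>; \<And>i. i \<in> I \<Longrightarrow> 0 \<le> \<nu> i;
        (\<Sum>i\<in>I. \<nu> i *\<^sub>R i) = \<rho> *\<^sub>R k; i \<in> I; 0 < \<nu> i\<rbrakk> \<Longrightarrow> i = k"
    by (rule optimal_cone_representation[OF compact_horizon horizon_sphere nz bal]) blast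
  have f0: "0 \<le> fst i" if "i \<in> I" for i using I horizon_fst that by blast
  have touch: "i = (1::real, q) /\<^sub>R norm (1::real, q)"
    if q: "q \<in> frontier G" "closed_segment x q \<subseteq> closure E"
      and \<nu>: "\<And>i. i \<in> I \<Longrightarrow> 0 \<le> \<nu> i" "(\<Sum>i\<in>I. \<nu> i *\<^sub>R i) = (1, q)" "i \<in> I" "0 < \<nu> i" for q \<nu> i
  proof (rule opt[where \<rho>="norm (1::real, q)" and \<nu>=\<nu>])
    show "(1, q) /\<^sub>R norm (1::real, q) \<in> horizon x" by (rule horizon_pointI[OF q])
    show "(\<Sum>i\<in>I. \<nu> i *\<^sub>R i) = norm (1::real, q) *\<^sub>R ((1, q) /\<^sub>R norm (1::real, q))"
      by (simp only: normalized_lift \<nu>(2))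
  qed (use \<nu> in auto)
  have reach: "x + (\<Sum>i\<in>I. \<nu> i *\<^sub>R (snd i - fst i *\<^sub>R x)) \<in> closure E"
    if \<nu>: "\<And>i. i \<in> I \<Longrightarrow> 0 \<le> \<nu> i" "(\<Sum>i\<in>I. \<nu> i * fst i) \<le> 1" for \<nu>
  proof (rule cone_sweep[OF x I(1,2) _ \<nu>])
    fix q \<mu>
    assume q: "q \<in> frontier G" "closed_segment x q \<subseteq> closure E"
      and \<mu>: "\<And>i. i \<in> I \<Longrightarrow> 0 \<le> \<mu> i" "(\<Sum>i\<in>I. \<mu> i * fst i) < 1"
        "q = x + (\<Sum>i\<in>I. \<mu> i *\<^sub>R (snd i - fst i *\<^sub>R x))"
    define r where "r = 1 - (\<Sum>i\<in>I. \<mu> i * fst i)"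
    have r: "r > 0" using \<mu> by (simp add: r_def)
    let ?\<eta> = "\<lambda>i. \<mu> i + r * c i"
    have \<eta>: "0 < ?\<eta> i" if "i \<in> I" for i using \<mu>(1)[OF that] c(1)[OF that] r by (simp add: add_nonneg_pos)
    have \<eta>0: "0 \<le> ?\<eta> i" if "i \<in> I" for i using \<eta>[OF that] by simp
    have "(\<Sum>i\<in>I. ?\<eta> i *\<^sub>R i) = (\<Sum>i\<in>I. \<mu> i *\<^sub>R i) + r *\<^sub>R (\<Sum>i\<in>I. c i *\<^sub>R i)"
      by (simp add: scaleR_add_left sum.distrib scaleR_sum_right)
    also have "\<dots> = (\<Sum>i\<in>I. \<mu> i *\<^sub>R i) + r *\<^sub>R (1, x)" by (simp only: c(2))
    also have "\<dots> = (1, q)"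
      unfolding \<mu>(3) by (simp add: prod_eq_iff fst_sum snd_sum r_def scaleR_diff_right sum_subtractf
          scaleR_diff_left scaleR_sum_left)
    finally have sum_q: "(\<Sum>i\<in>I. ?\<eta> i *\<^sub>R i) = (1, q)" .
    define k where "k = (1::real, q) /\<^sub>R norm (1::real, q)"
    have all: "i = k" if "i \<in> I" for i
      unfolding k_def by (rule touch[OF q _ sum_q that \<eta>[OF that]]) (rule \<eta>0)
    have "(\<Sum>i\<in>I. c i *\<^sub>R i) = (\<Sum>i\<in>I. c i *\<^sub>R k)" using all by (intro sum.cong) auto
    hence eq: "(1, x) = sum c I *\<^sub>R k" unfolding c(2) by (simp only: scaleR_sum_left)
    have fk: "fst k = inverse (norm (1::real, q))" "snd k = q /\<^sub>R norm (1::real, q)"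
      by (simp_all add: k_def)
    have "sum c I * inverse (norm (1::real, q)) = 1"
      using arg_cong[OF eq, of fst] fk by simp
    moreover have "x = (sum c I * inverse (norm (1::real, q))) *\<^sub>R q"
      using arg_cong[OF eq, of snd] fk by simp
    ultimately have "x = q" by simp
    thus False using x q(1) frontier_not_E by blast
  qed
  let ?V = "fin_points I" and ?D = "dir_points I"
  let ?C = "gen_conv ?V ?D"
  have C: "?C = {y. \<exists>\<nu>. (\<forall>i\<in>I. 0 \<le> \<nu> i) \<and> (\<Sum>i\<in>I. \<nu> i *\<^sub>R i) = (1, y)}"
    by (rule gen_conv_lift) (use I f0 in auto)
  have C_cl: "?C \<subseteq> closure E"
  proof
    fix y assume "y \<in> ?C"
    then obtain \<nu> where \<nu>: "\<forall>i\<in>I. 0 \<le> \<nu> i" "(\<Sum>i\<in>I. \<nu> i *\<^sub>R i) = (1, y)"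
      unfolding C by blast
    have "(\<Sum>i\<in>I. \<nu> i * fst i) = 1" "x + (\<Sum>i\<in>I. \<nu> i *\<^sub>R (snd i - fst i *\<^sub>R x)) = y"
      using \<nu>(2) unfolding lifted_combination[where x=x] by auto
    thus "y \<in> closure E" using reach[of \<nu>] \<nu>(1) by auto
  qed
  have x_ri: "x \<in> rel_interior ?C"
    by (rule rel_interior_gen_conv_lift[where c=c]) (use I c f0 in auto)
  have xC: "x \<in> ?C" using x_ri rel_interior_subset by blast
  have cvC: "convex ?C" by (simp add: gen_conv_def)
  have V_fr: "?V \<subseteq> frontier G" using I(2) by (auto simp: fin_points_def horizon_def)
  have diff: "?C - ?V \<subseteq> E"
  proof
    fix y assume y: "y \<in> ?C - ?V"
    show "y \<in> E"
    proof (rule closure_E_cases)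
      show "y \<in> closure E" using y C_cl by blast
      show "y \<notin> frontier G"
      proof
        assume fr: "y \<in> frontier G"
        obtain \<nu> where \<nu>: "\<forall>i\<in>I. 0 \<le> \<nu> i" "(\<Sum>i\<in>I. \<nu> i *\<^sub>R i) = (1, y)"
          using y unfolding C by blast
        have seg: "closed_segment x y \<subseteq> closure E"
          using closed_segment_subset[OF xC _ cvC, of y] y C_cl by blast
        have "\<exists>i\<in>I. 0 < \<nu> i"
        proof (rule ccontr)
          assume "\<not> ?thesis"
          hence "\<forall>i\<in>I. \<nu> i = 0" using \<nu>(1) by force
          hence "(\<Sum>i\<in>I. \<nu> i *\<^sub>R i) = 0" by simp
          thus False using \<nu>(2) by (simp add: zero_prod_def)
        qed
        then obtain i where i: "i \<in> I" "0 < \<nu> i" by blast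
        have ik: "i = (1::real, y) /\<^sub>R norm (1::real, y)"
          by (rule touch[OF fr seg _ \<nu>(2) i]) (use \<nu>(1) in auto)
        have n: "0 < norm (1::real, y)" by (rule norm_lift_pos)
        have fi: "fst i = inverse (norm (1::real, y))" and si: "snd i = y /\<^sub>R norm (1::real, y)"
          by (simp_all add: ik)
        have "snd i /\<^sub>R fst i = y" unfolding fi si using n by simp
        moreover have "0 < fst i" unfolding fi using n by simp
        ultimately have "y \<in> ?V" unfolding fin_points_def using i by force
        thus False using y by blast
      qed
    qed
  qed
  have "card ?D \<le> Suc 0"
  proof -
    let ?\<nu> = "\<lambda>i. if fst i = 0 then c i else 0"
    define r where "r = (\<Sum>i\<in>I. ?\<nu> i *\<^sub>R snd i)"
    have \<nu>0: "0 \<le> ?\<nu> i" if "i \<in> I" for i using c(1)[OF that] by simp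
    have f\<nu>: "?\<nu> i * fst i = 0" for i :: "real \<times> 'a" by simp
    have sum_r: "(\<Sum>i\<in>I. ?\<nu> i *\<^sub>R i) = (0, r)"
      unfolding lifted_sum_eq r_def f\<nu> by simp
    \<comment> \<open>the weighted sum of the vertices at infinity is a visible direction, hence a generator\<close>
    have single: "i = (0, r /\<^sub>R norm r)" if i: "i \<in> I" "fst i = 0" for i
    proof -
      have "r \<noteq> 0"
      proof
        assume "r = 0"
        hence "(\<Sum>i\<in>I. ?\<nu> i *\<^sub>R i) = 0" using sum_r by (simp add: zero_prod_def)
        moreover have "\<exists>v\<in>I. ?\<nu> v \<noteq> 0" using i c(1)[OF i(1)] by force
        ultimately have "dependent I"
          unfolding dependent_finite[OF I(1)] by (intro exI[of _ ?\<nu>] conjI)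
        thus False using I(3) by blast
      qed
      have "(0, r /\<^sub>R norm r) \<in> horizon x"
      proof (rule horizon_dirI)
        show "norm (r /\<^sub>R norm r) = 1" using \<open>r \<noteq> 0\<close> by simp
        fix s :: real assume s: "0 \<le> s"
        let ?\<mu> = "\<lambda>i. s / norm r * ?\<nu> i"
        have \<mu>f: "?\<mu> i * fst i = 0" for i :: "real \<times> 'a" by simp
        have "x + (\<Sum>i\<in>I. ?\<mu> i *\<^sub>R (snd i - fst i *\<^sub>R x)) \<in> closure E"
        proof (rule reach)
          show "0 \<le> ?\<mu> i" if "i \<in> I" for i using \<nu>0[OF that] s by (intro mult_nonneg_nonneg) auto
          show "(\<Sum>i\<in>I. ?\<mu> i * fst i) \<le> 1" unfolding \<mu>f by simp
        qed
        also have "(\<Sum>i\<in>I. ?\<mu> i *\<^sub>R (snd i - fst i *\<^sub>R x)) = (\<Sum>i\<in>I. (s / norm r) *\<^sub>R (?\<nu> i *\<^sub>R snd i))"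
          by (rule sum.cong) auto
        also have "\<dots> = s *\<^sub>R (r /\<^sub>R norm r)"
          unfolding scaleR_sum_right[symmetric] r_def[symmetric] by (simp add: divide_inverse)
        finally show "x + s *\<^sub>R (r /\<^sub>R norm r) \<in> closure E" .
      qed
      thus ?thesis
      proof (rule opt[where \<nu>="?\<nu>" and \<rho>="norm r"])
        show "(\<Sum>i\<in>I. ?\<nu> i *\<^sub>R i) = norm r *\<^sub>R (0, r /\<^sub>R norm r)"
          unfolding sum_r using \<open>r \<noteq> 0\<close> by simp
        show "0 < ?\<nu> i" using i c(1) by simp
      qed (use \<nu>0 i in simp_all)
    qed
    hence "?D \<subseteq> {r /\<^sub>R norm r}" by (force simp: dir_points_def)
    thus ?thesis using card_mono[of "{r /\<^sub>R norm r}" ?D] by simp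
  qed
  moreover have "gen_simplex ?C ?V ?D"
  proof -
    have "\<exists>i\<in>I. 0 < fst i"
    proof (rule ccontr)
      assume "\<not> ?thesis"
      hence "\<forall>i\<in>I. fst i = 0" using f0 by force
      hence "(\<Sum>i\<in>I. c i * fst i) = 0" by simp
      thus False using c(2) unfolding lifted_sum_eq by simp
    qed
    then obtain i0 where i0: "i0 \<in> I" "0 < fst i0" by blast
    show ?thesis
      by (rule gen_simplex_lift[OF I(1) order_trans[OF I(2) horizon_sphere] _ I(3) i0]) (rule f0)
  qed
  ultimately show ?thesis using x_ri V_fr C_cl diff
    by (intro exI[of _ ?C] exI[of _ ?V] exI[of _ ?D]) auto
qed

lemma balanced_if_simplex:
  assumes C: "gen_simplex C V D" and xC: "x \<in> C" and V: "V \<subseteq> frontier G" and cl: "C \<subseteq> closure E"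
  shows "(1, x) \<in> convex_cone hull (horizon x)"
proof -
  have fin: "finite V" "finite D" and Ceq: "C = gen_conv V D" and D1: "D \<subseteq> sphere 0 1"
    using C by (auto simp: gen_simplex_def gen_affinely_independent_def)
  define I where "I = Pair 1 ` V \<union> Pair (0::real) ` D"
  have I: "finite I" using fin by (simp add: I_def)
  have f0: "0 \<le> fst i" if "i \<in> I" for i using that by (auto simp: I_def)
  have "fin_points I = V" by (force simp: fin_points_def I_def)
  moreover have "dir_points I = D" by (force simp: dir_points_def I_def)
  ultimately have Clift: "C = {y. \<exists>\<nu>. (\<forall>i\<in>I. 0 \<le> \<nu> i) \<and> (\<Sum>i\<in>I. \<nu> i *\<^sub>R i) = (1, y)}"
    using gen_conv_lift[of I] I f0 Ceq by simp
  obtain \<nu> where \<nu>: "\<forall>i\<in>I. 0 \<le> \<nu> i" "(\<Sum>i\<in>I. \<nu> i *\<^sub>R i) = (1, x)"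
    using xC unfolding Clift by blast
  have cv: "convex C" unfolding Ceq by (simp add: gen_conv_def)
  have "i \<in> convex_cone hull (horizon x)" if i: "i \<in> I" for i
  proof -
    from i consider v where "v \<in> V" "i = (1, v)" | e where "e \<in> D" "i = (0, e)"
      by (auto simp: I_def)
    thus ?thesis
    proof cases
      case 1
      let ?\<delta> = "\<lambda>k. if k = i then 1 else 0 :: real"
      have "v \<in> C" unfolding Clift
        using sum_delta_scaleR[OF I i, of 1 "\<lambda>k. k"] 1
        by (intro CollectI exI[of _ ?\<delta>]) auto
      hence "closed_segment x v \<subseteq> closure E"
        using closed_segment_subset[OF xC _ cv] cl by blast
      thus ?thesis using V 1 visible_frontier_in_cone by blast
    next
      case 2
      have "(0, e) \<in> horizon x"
      proof (rule horizon_dirI)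
        show "norm e = 1" using 2 D1 by auto
        fix s :: real assume s: "0 \<le> s"
        let ?\<mu> = "\<lambda>k. \<nu> k + (if k = i then s else 0)"
        have "(\<Sum>k\<in>I. ?\<mu> k *\<^sub>R k) = (1, x) + s *\<^sub>R i"
          using \<nu>(2) sum_delta_scaleR[OF I i, of s "\<lambda>k. k"]
          by (simp only: scaleR_add_left sum.distrib)
        also have "\<dots> = (1, x + s *\<^sub>R e)" using 2 by simp
        finally have "x + s *\<^sub>R e \<in> C"
          unfolding Clift using \<nu>(1) s by (intro CollectI exI[of _ ?\<mu>]) auto
        thus "x + s *\<^sub>R e \<in> closure E" using cl by blast
      qed
      thus ?thesis using 2 by (simp add: hull_inc)
    qed
  qed
  hence "(\<Sum>i\<in>I. \<nu> i *\<^sub>R i) \<in> convex_cone hull (convex_cone hull (horizon x))"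
    using I \<nu>(1) by (intro convex_cone_hull_sum) auto
  thus ?thesis using \<nu>(2) by (simp only: hull_hull)
qed

text \<open>
  A vanishing convex combination of the horizon involves directions only, and with positive
  coefficients \<open>u\<close> of these every linear combination of them is also a nonnegative one.  The sweep along these
  directions is not blocked: from a visible frontier point the directions would lead back to \<open>x\<close>,
  and \<open>(1, x)\<close> would be in the cone after all.
\<close>
lemma line_if_not_pointed:
  assumes x: "x \<in> E" and unbal: "(1, x) \<notin> convex_cone hull (horizon x)"
    and zero: "0 \<in> convex hull (horizon x)"
  shows "\<exists>m. affine m \<and> aff_dim m = 1 \<and> x \<in> m \<and> m \<subseteq> E"
proof -
  let ?K = "convex_cone hull (horizon x)"
  obtain I where I: "finite I" "I \<subseteq> horizon x" "0 \<in> convex hull I"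
    using subsetD[OF equalityD1[OF caratheodory] zero] by blast
  obtain u where u: "\<And>i. i \<in> I \<Longrightarrow> 0 \<le> u i" "sum u I = 1" "(\<Sum>i\<in>I. u i *\<^sub>R i) = 0"
    using I by (auto simp: convex_hull_finite)
  define J where "J = {i \<in> I. 0 < u i}"
  have J: "finite J" "J \<subseteq> horizon x" "\<And>j. j \<in> J \<Longrightarrow> 0 < u j" using I by (auto simp: J_def)
  have sumJ: "(\<Sum>j\<in>J. u j *\<^sub>R f j) = (\<Sum>i\<in>I. u i *\<^sub>R f i)" for f :: "_ \<Rightarrow> 'b::real_vector"
    using I u(1) by (intro sum.mono_neutral_left) (auto simp: J_def order_le_less)
  have J_eq0: "(\<Sum>j\<in>J. u j *\<^sub>R j) = 0" using sumJ[of "\<lambda>j. j"] u by simp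
  have fst0: "fst j = 0" if "j \<in> J" for j
  proof -
    have "(\<Sum>j\<in>J. u j * fst j) = 0" using arg_cong[OF J_eq0, of fst] by (simp add: fst_sum)
    moreover have "0 \<le> u j * fst j" if "j \<in> J" for j
      using J(3)[OF that] horizon_fst[OF subsetD[OF J(2) that]] by simp
    ultimately have "u j * fst j = 0" using sum_nonneg_eq_0_iff[OF J(1), of "\<lambda>j. u j * fst j"] that by blast
    thus ?thesis using J(3)[OF that] by simp
  qed
  have snd0: "(\<Sum>j\<in>J. u j *\<^sub>R snd j) = 0" using arg_cong[OF J_eq0, of snd] by (simp add: snd_sum)
  obtain j where j: "j \<in> J"
  proof -
    have "J \<noteq> {}"
    proof
      assume "J = {}"
      hence "\<forall>i\<in>I. u i = 0" using u(1) by (auto simp: J_def order_le_less)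
      hence "sum u I = 0" by simp
      thus False using u(2) by simp
    qed
    thus ?thesis using that by blast
  qed
  have no_touch: False
    if q: "q \<in> frontier G" "closed_segment x q \<subseteq> closure E"
      and \<mu>: "\<And>i. i \<in> J \<Longrightarrow> 0 \<le> \<mu> i" "q = x + (\<Sum>i\<in>J. \<mu> i *\<^sub>R snd i)" for q \<mu>
  proof -
    obtain \<epsilon> where \<epsilon>: "\<epsilon> > 0" "\<And>i. i \<in> J \<Longrightarrow> \<epsilon> * \<mu> i \<le> u i"
      using small_multiple_le[of J u \<mu>] J by (metis less_imp_le order_refl)
    have nn: "0 \<le> u i / \<epsilon> - \<mu> i" if "i \<in> J" for i using \<epsilon>(2)[OF that] \<epsilon>(1) by (simp add: field_simps)
    have "(\<Sum>i\<in>J. (u i / \<epsilon> - \<mu> i) *\<^sub>R i) \<in> ?K"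
      using J nn by (intro convex_cone_hull_sum) auto
    moreover have "(\<Sum>i\<in>J. (u i / \<epsilon> - \<mu> i) *\<^sub>R i) = (0, - (\<Sum>i\<in>J. \<mu> i *\<^sub>R snd i))"
    proof -
      have "(\<Sum>i\<in>J. (u i / \<epsilon> - \<mu> i) *\<^sub>R i) = (1 / \<epsilon>) *\<^sub>R (\<Sum>i\<in>J. u i *\<^sub>R i) - (\<Sum>i\<in>J. \<mu> i *\<^sub>R i)"
        by (simp add: scaleR_diff_left sum_subtractf scaleR_sum_right)
      also have "\<dots> = - (\<Sum>i\<in>J. \<mu> i *\<^sub>R i)" using J_eq0 by simp
      finally show ?thesis using fst0 by (simp add: prod_eq_iff fst_sum snd_sum)
    qed
    ultimately have neg: "(0, - (\<Sum>i\<in>J. \<mu> i *\<^sub>R snd i)) \<in> ?K" by simp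
    have "(1, q) \<in> ?K" by (rule visible_frontier_in_cone[OF q])
    from convex_cone_hull_add[OF this neg] have "(1, x) \<in> ?K" unfolding \<mu>(2) by simp
    thus False using unbal by blast
  qed
  have dsum: "(\<Sum>i\<in>J. \<mu> i *\<^sub>R (snd i - fst i *\<^sub>R x)) = (\<Sum>i\<in>J. \<mu> i *\<^sub>R snd i)" for \<mu>
    using fst0 by (intro sum.cong) auto
  have cl: "x + (\<Sum>i\<in>J. \<mu> i *\<^sub>R snd i) \<in> closure E" if \<mu>: "\<And>i. i \<in> J \<Longrightarrow> 0 \<le> \<mu> i" for \<mu>
  proof -
    have "x + (\<Sum>i\<in>J. \<mu> i *\<^sub>R (snd i - fst i *\<^sub>R x)) \<in> closure E"
    proof (rule cone_sweep[OF x J(1,2)])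
      have "(\<Sum>i\<in>J. \<mu> i * fst i) = 0" using fst0 by simp
      thus "(\<Sum>i\<in>J. \<mu> i * fst i) \<le> 1" by simp
      show False if "q \<in> frontier G" "closed_segment x q \<subseteq> closure E"
        "\<And>i. i \<in> J \<Longrightarrow> 0 \<le> \<eta> i" "q = x + (\<Sum>i\<in>J. \<eta> i *\<^sub>R (snd i - fst i *\<^sub>R x))" for q \<eta>
        using no_touch[OF that(1,2), of \<eta>] that(3,4) dsum[of \<eta>] by auto
    qed (rule \<mu>)
    thus ?thesis by (simp add: dsum)
  qed
  have inE: "x + (\<Sum>i\<in>J. \<mu> i *\<^sub>R snd i) \<in> E" if \<mu>: "\<And>i. i \<in> J \<Longrightarrow> 0 \<le> \<mu> i" for \<mu>
  proof (rule closure_E_cases[OF cl[OF \<mu>]])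
    let ?q = "x + (\<Sum>i\<in>J. \<mu> i *\<^sub>R snd i)"
    have "closed_segment x ?q \<subseteq> closure E"
    proof
      fix y assume "y \<in> closed_segment x ?q"
      then obtain t where t: "0 \<le> t" "t \<le> 1" "y = (1 - t) *\<^sub>R x + t *\<^sub>R ?q"
        by (auto simp: closed_segment_def)
      have "y = x + (\<Sum>i\<in>J. (t * \<mu> i) *\<^sub>R snd i)"
        unfolding t by (simp add: scaleR_add_right scaleR_diff_left scaleR_sum_right)
      thus "y \<in> closure E" using cl[of "\<lambda>i. t * \<mu> i"] \<mu> t by auto
    qed
    thus "?q \<notin> frontier G" using no_touch[of ?q \<mu>] \<mu> by blast
  qed
  let ?e = "snd j"
  have e0: "?e \<noteq> 0"
  proof
    assume "?e = 0"
    hence "norm j = 0" using fst0[OF j] by (simp add: prod_eq_iff)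
    thus False using J(2) j horizon_sphere by force
  qed
  have line: "x + t *\<^sub>R ?e \<in> E" for t
  proof -
    \<comment> \<open>adding a multiple of the vanishing combination makes the coefficient of \<open>j\<close> nonnegative\<close>
    let ?\<mu> = "\<lambda>i. (if i = j then t else 0) + \<bar>t\<bar> / u j * u i"
    have nn: "0 \<le> ?\<mu> i" if "i \<in> J" for i
    proof (cases "i = j")
      case True
      thus ?thesis using J(3)[OF j] by simp
    next
      case False
      thus ?thesis using J(3)[OF j] J(3)[OF that] by simp
    qed
    have "(\<Sum>i\<in>J. ?\<mu> i *\<^sub>R snd i) = t *\<^sub>R ?e + (\<bar>t\<bar> / u j) *\<^sub>R (\<Sum>i\<in>J. u i *\<^sub>R snd i)"
      using sum_delta_scaleR[OF J(1) j, of t snd]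
      by (simp only: scaleR_add_left sum.distrib scaleR_sum_right scaleR_scaleR)
    thus ?thesis using inE[of ?\<mu>] nn snd0 by simp
  qed
  let ?m = "affine hull {x, x + ?e}"
  have "?m \<subseteq> E"
    using line by (auto simp: affine_hull_2_alt)
  moreover have "aff_dim ?m = 1" using e0 by simp
  moreover have "x \<in> ?m" by (simp add: hull_inc)
  ultimately show ?thesis using affine_affine_hull by blast
qed

text \<open>
  The separating functional is written as \<open>(c, g)\<close>.  All visible frontier points and visible
  directions lie strictly on the side where \<open>g\<close> is larger than at \<open>x\<close>.  On the other side nothing
  blocks the view, so the visible part \<open>S\<close> is closed and convex, and it is bounded because otherwise
  it would contain a ray.  At an extreme point \<open>p\<close> of the face of \<open>S\<close> where \<open>g\<close> is least, the segment in
  \<open>E\<close> around \<open>p\<close> is still visible from \<open>x\<close> if it is short; minimality forces it into the face.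
\<close>
lemma pointed_unbalanced_impossible:
  assumes x: "x \<in> E" and unbal: "(1, x) \<notin> convex_cone hull (horizon x)"
    and zero: "0 \<notin> convex hull (horizon x)"
  shows False
proof -
  let ?T = "insert (- (1, x)) (horizon x)"
  have "0 \<notin> convex hull ?T"
  proof
    assume 0: "0 \<in> convex hull ?T"
    show False
    proof (cases "horizon x = {}")
      case True
      thus False using 0 by (simp add: zero_prod_def)
    next
      case False
      then obtain u v b where uv: "0 \<le> u" "0 \<le> v" "u + v = 1" "b \<in> convex hull (horizon x)"
        "0 = u *\<^sub>R (- (1, x)) + v *\<^sub>R b"
        using 0 by (auto simp: convex_hull_insert)
      have eq: "u *\<^sub>R (1, x) = v *\<^sub>R b"
      proof -
        have "u *\<^sub>R (1, x) = u *\<^sub>R (1, x) + (u *\<^sub>R (- (1, x)) + v *\<^sub>R b)"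
          unfolding uv(5)[symmetric] by simp
        also have "\<dots> = v *\<^sub>R b" unfolding scaleR_minus_right by (simp only: add_minus_cancel)
        finally show ?thesis .
      qed
      show False
      proof (cases "u = 0")
        case True
        hence "v = 1" using uv(3) by simp
        moreover have "v *\<^sub>R b = 0" using eq True by (simp only: scaleR_zero_left)
        ultimately have "b = 0" by simp
        thus False using uv(4) zero by simp
      next
        case False
        have "(1, x) = (1 / u) *\<^sub>R (u *\<^sub>R (1, x))" using False by simp
        also have "\<dots> = (v / u) *\<^sub>R b" unfolding eq by simp
        also have "\<dots> \<in> convex_cone hull (horizon x)"
          using uv convex_hull_subset_convex_cone_hull
          by (intro convex_cone_hull_mul) auto
        finally show False using unbal by blast
      qed
    qed
  qed
  moreover have "closed (convex hull ?T)"
    using compact_horizon by (intro compact_imp_closed compact_convex_hull compact_insert)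
  ultimately obtain a b where ab: "0 < b" "\<And>p. p \<in> convex hull ?T \<Longrightarrow> b < a \<bullet> p"
    using separating_hyperplane_closed_0[OF convex_convex_hull, of ?T] by auto
  define c where "c = fst a"
  define g where "g = snd a"
  have a: "a \<bullet> (s, y) = c * s + g \<bullet> y" for s y by (simp add: c_def g_def inner_prod_def)
  have gx: "c + g \<bullet> x < 0"
  proof -
    have "b < a \<bullet> (- (1, x))" by (intro ab(2) hull_inc) simp
    also have "a \<bullet> (- (1, x)) = - (c + g \<bullet> x)" unfolding inner_minus_right a by simp
    finally show ?thesis using ab(1) by simp
  qed
  have hor: "0 < a \<bullet> p" if "p \<in> horizon x" for p
    using ab(1) ab(2)[of p] that by (simp add: hull_inc)
  have touch: "0 < g \<bullet> (q - x)" if q: "q \<in> frontier G" "closed_segment x q \<subseteq> closure E" for q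
  proof -
    have "0 < a \<bullet> ((1::real, q) /\<^sub>R norm (1::real, q))" using hor horizon_pointI[OF q] by blast
    hence "0 < norm (1::real, q) * (a \<bullet> ((1::real, q) /\<^sub>R norm (1::real, q)))"
      by (intro mult_pos_pos norm_lift_pos)
    also have "\<dots> = a \<bullet> (1, q)" by (simp only: inner_scaleR_right[symmetric] normalized_lift)
    finally have "0 < c + g \<bullet> q" using a[of 1 q] by simp
    thus ?thesis using gx by (simp add: inner_diff_right)
  qed
  define S where "S = {y. closed_segment x y \<subseteq> closure E \<and> g \<bullet> (y - x) \<le> 0}"
  have segE: "closed_segment x y \<subseteq> E" if y: "y \<in> S" for y
  proof
    fix q assume q: "q \<in> closed_segment x y"
    have "closed_segment x q \<subseteq> closed_segment x y" using q by (simp add: subset_closed_segment)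
    hence sq: "closed_segment x q \<subseteq> closure E" using y by (auto simp: S_def)
    obtain t where t: "0 \<le> t" "q = (1 - t) *\<^sub>R x + t *\<^sub>R y" using q by (auto simp: closed_segment_def)
    have "q - x = t *\<^sub>R (y - x)" unfolding t by (simp add: algebra_simps)
    hence "g \<bullet> (q - x) = t * (g \<bullet> (y - x))" by simp
    also have "\<dots> \<le> 0" using t y by (simp add: S_def mult_nonneg_nonpos)
    finally have "q \<notin> frontier G" using touch[OF _ sq] by force
    thus "q \<in> E" using sq by (intro closure_E_cases) auto
  qed
  have seg_alt: "closed_segment x y \<subseteq> closure E \<longleftrightarrow> (\<forall>u\<in>{0..1}. x + u *\<^sub>R (y - x) \<in> closure E)" for y
  proof -
    have "closed_segment x y = (\<lambda>u. x + u *\<^sub>R (y - x)) ` {0..1}"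
      unfolding closed_segment_image_interval by (simp add: algebra_simps)
    thus ?thesis by (simp add: image_subset_iff)
  qed
  have "closed S"
  proof -
    have "S = (\<Inter>u\<in>{0..1}. (\<lambda>y. x + u *\<^sub>R (y - x)) -` closure E) \<inter> (\<lambda>y. g \<bullet> (y - x)) -` {..0}"
      unfolding S_def seg_alt by auto
    moreover have "closed ((\<lambda>y. x + u *\<^sub>R (y - x)) -` closure E)" for u
      by (intro continuous_closed_vimage closed_closure) (auto intro!: continuous_intros)
    moreover have "closed ((\<lambda>y. g \<bullet> (y - x)) -` {..0})"
      by (intro continuous_closed_vimage closed_atMost) (auto intro!: continuous_intros)
    ultimately show ?thesis by auto
  qed
  moreover have "bounded S"
  proof (rule ccontr)
    assume unb: "\<not> bounded S"
    have "\<exists>y\<in>S. real (Suc n) < norm (y - x)" for n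
    proof (rule ccontr)
      assume "\<not> ?thesis"
      hence "S \<subseteq> cball x (real (Suc n))" by (auto simp: dist_norm norm_minus_commute not_less)
      thus False using unb bounded_subset bounded_cball by blast
    qed
    then obtain Y where Y: "\<And>n. Y n \<in> S" "\<And>n. real (Suc n) < norm (Y n - x)" by metis
    define e where "e n = (Y n - x) /\<^sub>R norm (Y n - x)" for n
    have n0: "0 < norm (Y n - x)" for n using Y(2)[of n] by (smt (verit) of_nat_0_le_iff)
    have "\<forall>n. e n \<in> sphere 0 1" using n0 by (auto simp: e_def)
    then obtain d r where d: "d \<in> sphere (0::'a) 1" "strict_mono (r::nat\<Rightarrow>nat)" "(e \<circ> r) \<longlonglongrightarrow> d"
      using compact_sphere[of "0::'a" 1] unfolding compact_def by metis
    have "(0, d) \<in> horizon x"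
    proof (rule horizon_dirI)
      show "norm d = 1" using d by simp
      fix s :: real assume s: "0 \<le> s"
      show "x + s *\<^sub>R d \<in> closure E"
      proof (rule Lim_in_closed_set[OF closed_closure _ sequentially_bot])
        show "(\<lambda>n. x + s *\<^sub>R (e \<circ> r) n) \<longlonglongrightarrow> x + s *\<^sub>R d" by (intro tendsto_intros d)
        show "\<forall>\<^sub>F n in sequentially. x + s *\<^sub>R (e \<circ> r) n \<in> closure E"
        proof (rule eventually_sequentiallyI[of "nat \<lceil>s\<rceil>"])
          fix n assume n: "nat \<lceil>s\<rceil> \<le> n"
          have "s \<le> real n" using n by linarith
          also have "real n \<le> real (r n)" using seq_suble[OF d(2)] by simp
          also have "\<dots> \<le> norm (Y (r n) - x)" using Y(2)[of "r n"] by simp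
          finally have "s / norm (Y (r n) - x) \<le> 1" using n0 by (simp add: divide_le_eq)
          moreover have "0 \<le> s / norm (Y (r n) - x)" using s by simp
          ultimately have "x + (s / norm (Y (r n) - x)) *\<^sub>R (Y (r n) - x) \<in> closure E"
            using Y(1)[of "r n"] unfolding S_def seg_alt by auto
          thus "x + s *\<^sub>R (e \<circ> r) n \<in> closure E" by (simp add: e_def divide_inverse)
        qed
      qed
    qed
    hence "0 < g \<bullet> d" using hor[of "(0, d)"] a[of 0 d] by simp
    moreover have "g \<bullet> d \<le> 0"
    proof (rule LIMSEQ_le_const2)
      show "(\<lambda>n. g \<bullet> (e \<circ> r) n) \<longlonglongrightarrow> g \<bullet> d" by (intro tendsto_intros d)
      have "g \<bullet> (e \<circ> r) n \<le> 0" for n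
        using Y(1)[of "r n"] n0[of "r n"]
        by (auto simp: e_def S_def mult_nonneg_nonpos)
      thus "\<exists>N. \<forall>n\<ge>N. g \<bullet> (e \<circ> r) n \<le> 0" by blast
    qed
    ultimately show False by simp
  qed
  ultimately have cS: "compact S" by (simp add: compact_eq_bounded_closed)
  have cvS: "convex S"
  proof (rule convexI)
    fix y z and u v :: real
    assume yz: "y \<in> S" "z \<in> S" and uv: "0 \<le> u" "0 \<le> v" "u + v = 1"
    let ?P = "convex hull (insert x {y, z})"
    have gP: "g \<bullet> (p - x) \<le> 0" if "p \<in> ?P" for p
    proof -
      have "?P \<subseteq> {p. g \<bullet> p \<le> g \<bullet> x}"
        using yz by (intro hull_minimal convex_halfspace_le) (auto simp: S_def inner_diff_right)
      thus ?thesis using that by (auto simp: inner_diff_right)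
    qed
    have "?P \<subseteq> closure E"
    proof -
      have "?P \<subseteq> closure E \<or> (\<exists>t p. 0 \<le> t \<and> t < 1 \<and> p \<in> ?P \<and>
        x + t *\<^sub>R (p - x) \<in> frontier G \<and> closed_segment x (x + t *\<^sub>R (p - x)) \<subseteq> closure E)"
        by (rule sweep[OF x]) (use yz in \<open>auto simp: S_def\<close>)
      moreover have False if "0 \<le> t" "p \<in> ?P" "x + t *\<^sub>R (p - x) \<in> frontier G"
        "closed_segment x (x + t *\<^sub>R (p - x)) \<subseteq> closure E" for t p
        using touch[OF that(3,4)] gP[OF that(2)] that(1) by (simp add: mult_le_0_iff zero_less_mult_iff)
      ultimately show ?thesis by blast
    qed
    moreover have w: "u *\<^sub>R y + v *\<^sub>R z \<in> ?P"
      using uv by (intro convexD convex_convex_hull) (auto simp: hull_inc)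
    moreover have "closed_segment x (u *\<^sub>R y + v *\<^sub>R z) \<subseteq> ?P"
      using w by (intro closed_segment_subset convex_convex_hull) (auto simp: hull_inc)
    ultimately show "u *\<^sub>R y + v *\<^sub>R z \<in> S" using gP[OF w] by (auto simp: S_def)
  qed
  have "x \<in> S" using x closure_subset by (auto simp: S_def)
  hence "S \<noteq> {}" by blast
  moreover have "continuous_on S (\<lambda>y. g \<bullet> y)" by (intro continuous_intros)
  ultimately obtain y0 where y0: "y0 \<in> S" "\<And>y. y \<in> S \<Longrightarrow> g \<bullet> y0 \<le> g \<bullet> y"
    using continuous_attains_inf[OF cS, of "\<lambda>y. g \<bullet> y"] by blast
  define F where "F = S \<inter> {y. g \<bullet> y = g \<bullet> y0}"
  have "compact F" unfolding F_def by (intro compact_Int_closed cS closed_hyperplane)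
  moreover have "convex F" unfolding F_def by (intro convex_Int cvS convex_hyperplane)
  moreover have "F \<noteq> {}" using y0 by (auto simp: F_def)
  ultimately obtain p where p: "p extreme_point_of F" by (rule extreme_point_exists_convex)
  hence pF: "p \<in> F" by (simp add: extreme_point_of_def)
  hence pS: "p \<in> S" "g \<bullet> p = g \<bullet> y0" by (auto simp: F_def)
  have "p \<in> E" using segE[OF pS(1)] by auto
  then obtain u0 where u0: "u0 \<noteq> 0" "closed_segment (p - u0) (p + u0) \<subseteq> E"
    using not_extreme by blast
  \<comment> \<open>oriented so that a step in direction \<open>u\<close> does not leave the half-space, even if \<open>p = x\<close>\<close>
  define u where "u = (if g \<bullet> u0 \<le> 0 then u0 else - u0)"
  have u: "u \<noteq> 0" "closed_segment (p - u) (p + u) \<subseteq> E" "g \<bullet> u \<le> 0"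
    using u0 by (auto simp: u_def closed_segment_commute)
  have "closed_segment x p \<subseteq> G" using segE[OF pS(1)] E_subset by blast
  then obtain \<epsilon> where \<epsilon>: "\<epsilon> > 0" "(\<Union>y\<in>closed_segment x p. ball y \<epsilon>) \<subseteq> G"
    using compact_subset_open_imp_ball_epsilon_subset[OF compact_segment open_G] by blast
  have near: "closed_segment x p' \<subseteq> E" if p': "p' \<in> E" "dist p p' < \<epsilon>" for p'
  proof (rule segment_in_E[OF x p'(1)], rule subsetI)
    fix q assume "q \<in> closed_segment x p'"
    then obtain t where t: "0 \<le> t" "t \<le> 1" "q = (1 - t) *\<^sub>R x + t *\<^sub>R p'"
      by (auto simp: closed_segment_def)
    have "dist ((1 - t) *\<^sub>R x + t *\<^sub>R p) q = t * dist p p'"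
      using t by (simp add: dist_norm scaleR_diff_right[symmetric])
    also have "\<dots> \<le> 1 * dist p p'" using t by (intro mult_right_mono) auto
    finally have "q \<in> ball ((1 - t) *\<^sub>R x + t *\<^sub>R p) \<epsilon>" using p' by simp
    thus "q \<in> G" using \<epsilon>(2) t by (force simp: closed_segment_def)
  qed
  define s where "s = min 1 (\<epsilon> / (2 * norm u))"
  have s: "0 < s" "s \<le> 1" using \<epsilon> u by (auto simp: s_def)
  have "s * norm u \<le> \<epsilon> / (2 * norm u) * norm u" by (intro mult_right_mono) (auto simp: s_def)
  also have "\<dots> < \<epsilon>" using u \<epsilon> by simp
  finally have su: "s * norm u < \<epsilon>" .
  have mem: "p + r *\<^sub>R u \<in> E" if "\<bar>r\<bar> \<le> s" for r
  proof -
    have dbl: "(2 * w) *\<^sub>R u = w *\<^sub>R u + w *\<^sub>R u" for w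
      by (simp only: mult_2 scaleR_add_left)
    have "p + (2 * w - 1) *\<^sub>R u = (1 - w) *\<^sub>R (p - u) + w *\<^sub>R (p + u)" for w
      by (simp add: scaleR_diff_left scaleR_diff_right scaleR_add_right dbl)
    from this[of "(1 + r) / 2"]
    have "p + r *\<^sub>R u = (1 - (1 + r) / 2) *\<^sub>R (p - u) + ((1 + r) / 2) *\<^sub>R (p + u)"
      by (simp add: field_simps)
    hence "p + r *\<^sub>R u \<in> closed_segment (p - u) (p + u)"
      unfolding closed_segment_def using that s
      by (intro CollectI exI[of _ "(1 + r) / 2"]) auto
    thus ?thesis using u by blast
  qed
  have seg: "closed_segment x (p + r *\<^sub>R u) \<subseteq> closure E" if r: "\<bar>r\<bar> = s" for r
  proof -
    have "closed_segment x (p + r *\<^sub>R u) \<subseteq> E"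
      using mem[of r] r s su by (intro near) (auto simp: dist_norm)
    thus ?thesis using closure_subset by blast
  qed
  have px: "g \<bullet> p \<le> g \<bullet> x" using pS by (simp add: S_def inner_diff_right)
  have plus: "p + s *\<^sub>R u \<in> S"
  proof -
    have "g \<bullet> (p + s *\<^sub>R u - x) = (g \<bullet> p - g \<bullet> x) + s * (g \<bullet> u)"
      by (simp add: inner_diff_right inner_add_right)
    also have "\<dots> \<le> 0" using px s u(3) by (intro add_nonpos_nonpos mult_nonneg_nonpos) auto
    finally show ?thesis using seg[of s] s by (simp add: S_def)
  qed
  have "g \<bullet> y0 \<le> g \<bullet> (p + s *\<^sub>R u)" by (rule y0(2)[OF plus])
  hence "0 \<le> s * (g \<bullet> u)" using pS by (simp add: inner_add_right)
  hence gu: "g \<bullet> u = 0" using s u(3) by (simp add: zero_le_mult_iff)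
  have minus: "p + (- s) *\<^sub>R u \<in> S"
    using seg[of "- s"] s gu px by (simp add: S_def inner_diff_right)
  have "p + s *\<^sub>R u \<in> F" "p + (- s) *\<^sub>R u \<in> F"
    using plus minus pS gu by (auto simp: F_def inner_add_right inner_diff_right)
  moreover have "p \<in> open_segment (p + (- s) *\<^sub>R u) (p + s *\<^sub>R u)"
  proof -
    have "midpoint (p + (- s) *\<^sub>R u) (p + s *\<^sub>R u) = p"
      by (simp add: midpoint_def scaleR_2[symmetric])
    moreover have "p + (- s) *\<^sub>R u \<noteq> p + s *\<^sub>R u"
    proof
      assume eq: "p + (- s) *\<^sub>R u = p + s *\<^sub>R u"
      have "(s + s) *\<^sub>R u = (p + s *\<^sub>R u) - (p + (- s) *\<^sub>R u)"
        unfolding scaleR_add_left by simp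
      also have "\<dots> = 0" unfolding eq by simp
      finally show False using s u by simp
    qed
    ultimately show ?thesis using midpoint_in_open_segment by metis
  qed
  ultimately show False using p unfolding extreme_point_of_def by blast
qed

theorem line_or_balanced:
  assumes "x \<in> E"
  shows "(\<exists>m. affine m \<and> aff_dim m = 1 \<and> x \<in> m \<and> m \<subseteq> E) \<or> (1, x) \<in> convex_cone hull (horizon x)"
  using line_if_not_pointed[OF assms] pointed_unbalanced_impossible[OF assms] by blast

end

section \<open>The minimal locally concave function\<close>

text \<open>
  The subgraph condition compares arbitrary pairs of points of a segment.  Such a pair spans a
  segment that also lies in \<open>\<Omega>\<close>, so it suffices to compare the endpoints.
\<close>
lemma locally_concave_on_iff:
  "locally_concave_on \<Omega> B \<longleftrightarrow>
    (\<forall>a b t \<alpha> \<beta>. closed_segment a b \<subseteq> \<Omega> \<longrightarrow> 0 \<le> t \<longrightarrow> t \<le> 1 \<longrightarrow> ereal \<alpha> \<le> B a \<longrightarrow> ereal \<beta> \<le> B b \<longrightarrow>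
       ereal ((1 - t) * \<alpha> + t * \<beta>) \<le> B ((1 - t) *\<^sub>R a + t *\<^sub>R b))" (is "_ \<longleftrightarrow> ?R")
proof
  assume lc: "locally_concave_on \<Omega> B"
  show ?R
  proof (intro allI impI)
    fix a b and t \<alpha> \<beta> :: real
    assume *: "closed_segment a b \<subseteq> \<Omega>" "0 \<le> t" "t \<le> 1" "ereal \<alpha> \<le> B a" "ereal \<beta> \<le> B b"
    let ?S = "{(z, s::real). z \<in> closed_segment a b \<and> ereal s \<le> B z}"
    have "convex ?S" using lc * by (simp add: locally_concave_on_def concave_ereal_on_def)
    hence "(1 - t) *\<^sub>R (a, \<alpha>) + t *\<^sub>R (b, \<beta>) \<in> ?S"
      using * by (intro convexD_alt) auto
    thus "ereal ((1 - t) * \<alpha> + t * \<beta>) \<le> B ((1 - t) *\<^sub>R a + t *\<^sub>R b)" by simp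
  qed
next
  assume R: ?R
  show "locally_concave_on \<Omega> B"
    unfolding locally_concave_on_def concave_ereal_on_def
  proof (intro allI impI)
    fix a b assume ab: "closed_segment a b \<subseteq> \<Omega>"
    let ?S = "{(z, s::real). z \<in> closed_segment a b \<and> ereal s \<le> B z}"
    show "convex ?S"
    proof (rule convexI)
      fix p q and u v :: real
      assume pq: "p \<in> ?S" "q \<in> ?S" and uv: "0 \<le> u" "0 \<le> v" "u + v = 1"
      obtain y s z r where p: "p = (y, s)" and q: "q = (z, r)" by (cases p, cases q)
      have *: "y \<in> closed_segment a b" "ereal s \<le> B y" "z \<in> closed_segment a b" "ereal r \<le> B z"
        using pq by (auto simp: p q)
      have u: "u = 1 - v" "v \<le> 1" using uv by auto
      have yz: "closed_segment y z \<subseteq> closed_segment a b"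
        using * by (simp add: subset_closed_segment)
      have "ereal ((1 - v) * s + v * r) \<le> B ((1 - v) *\<^sub>R y + v *\<^sub>R z)"
        by (rule R[rule_format, OF order_trans[OF yz ab] uv(2) u(2) *(2,4)])
      moreover have "(1 - v) *\<^sub>R y + v *\<^sub>R z \<in> closed_segment a b"
        using yz uv u by (auto simp: closed_segment_def)
      ultimately show "u *\<^sub>R p + v *\<^sub>R q \<in> ?S" by (simp add: u p q)
    qed
  qed
qed

lemma locally_concave_onD:
  assumes "locally_concave_on \<Omega> B" "closed_segment a b \<subseteq> \<Omega>" "0 \<le> t" "t \<le> 1"
    "ereal \<alpha> \<le> B a" "ereal \<beta> \<le> B b"
  shows "ereal ((1 - t) * \<alpha> + t * \<beta>) \<le> B ((1 - t) *\<^sub>R a + t *\<^sub>R b)"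
  using assms unfolding locally_concave_on_iff by simp

lemma min_loc_concave_le:
  assumes "locally_concave_on \<Omega> B" "\<And>y. y \<in> \<Omega> \<Longrightarrow> f y \<le> B y"
  shows "min_loc_concave \<Omega> f x \<le> B x"
  unfolding min_loc_concave_def using assms by (intro Inf_lower) blast

lemma min_loc_concave_ge:
  assumes "\<And>B. \<lbrakk>locally_concave_on \<Omega> B; \<And>y. y \<in> \<Omega> \<Longrightarrow> f y \<le> B y\<rbrakk> \<Longrightarrow> c \<le> B x"
  shows "c \<le> min_loc_concave \<Omega> f x"
  unfolding min_loc_concave_def using assms by (intro Inf_greatest) blast

lemma locally_concave_min_loc_concave: "locally_concave_on \<Omega> (min_loc_concave \<Omega> f)"
  unfolding locally_concave_on_iff
proof (intro allI impI)
  fix a b and t \<alpha> \<beta> :: real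
  assume *: "closed_segment a b \<subseteq> \<Omega>" "0 \<le> t" "t \<le> 1"
    "ereal \<alpha> \<le> min_loc_concave \<Omega> f a" "ereal \<beta> \<le> min_loc_concave \<Omega> f b"
  show "ereal ((1 - t) * \<alpha> + t * \<beta>) \<le> min_loc_concave \<Omega> f ((1 - t) *\<^sub>R a + t *\<^sub>R b)"
  proof (rule min_loc_concave_ge)
    fix B :: "'a \<Rightarrow> ereal"
    assume B: "locally_concave_on \<Omega> B" "\<And>y. y \<in> \<Omega> \<Longrightarrow> f y \<le> B y"
    have "ereal \<alpha> \<le> B a" "ereal \<beta> \<le> B b"
      using * min_loc_concave_le[OF B] order_trans by blast+
    thus "ereal ((1 - t) * \<alpha> + t * \<beta>) \<le> B ((1 - t) *\<^sub>R a + t *\<^sub>R b)"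
      using * by (intro locally_concave_onD[OF B(1)])
  qed
qed

lemma le_min_loc_concave: "y \<in> \<Omega> \<Longrightarrow> f y \<le> min_loc_concave \<Omega> f y"
  by (rule min_loc_concave_ge) blast

lemma affine_functional_combination:
  assumes "affine_functional L"
  shows "L ((1 - t) *\<^sub>R y + t *\<^sub>R z) = (1 - t) * L y + t * L z"
proof -
  obtain g c where g: "linear g" "L = (\<lambda>x. g x + c)" using assms by (auto simp: affine_functional_def)
  have "g ((1 - t) *\<^sub>R y + t *\<^sub>R z) = (1 - t) * g y + t * g z"
    by (simp only: linear_add[OF g(1)] linear_scale[OF g(1)] real_scaleR_def)
  thus ?thesis by (simp add: g(2) algebra_simps)
qed

lemma affine_functional_along:
  assumes "affine_functional L"
  shows "L (y + t *\<^sub>R (z - y)) = (1 - t) * L y + t * L z"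
proof -
  have "y + t *\<^sub>R (z - y) = (1 - t) *\<^sub>R y + t *\<^sub>R z" by (simp add: algebra_simps)
  thus ?thesis by (simp only: affine_functional_combination[OF assms])
qed

lemma continuous_on_affine_functional:
  fixes L :: "'a::euclidean_space \<Rightarrow> real"
  assumes "affine_functional L"
  shows "continuous_on S L"
proof -
  obtain g c where g: "linear g" "L = (\<lambda>x. g x + c)" using assms by (auto simp: affine_functional_def)
  have "continuous_on S g" using g(1) by (simp add: linear_continuous_on linear_conv_bounded_linear)
  thus ?thesis unfolding g(2) by (intro continuous_intros)
qed

lemma eventually_scaled_in_interior:
  fixes y z :: "'a::real_normed_vector"
  assumes "y \<in> interior S"
  shows "\<forall>\<^sub>F \<tau> in at_right (0::real). y + \<tau> *\<^sub>R (z - y) \<in> S"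
proof -
  have "((\<lambda>\<tau>::real. y + \<tau> *\<^sub>R (z - y)) \<longlongrightarrow> y + 0 *\<^sub>R (z - y)) (at_right 0)"
    by (intro tendsto_intros)
  hence "\<forall>\<^sub>F \<tau> in at_right (0::real). y + \<tau> *\<^sub>R (z - y) \<in> interior S"
    using assms by (intro topological_tendstoD[OF _ open_interior]) auto
  thus ?thesis by eventually_elim (use interior_subset in blast)
qed

lemma scaled_in_interior2:
  fixes y z z' :: "'a::real_normed_vector"
  assumes "y \<in> interior S"
  obtains \<tau> :: real where "0 < \<tau>" "\<tau> \<le> 1" "y + \<tau> *\<^sub>R (z - y) \<in> S" "y + \<tau> *\<^sub>R (z' - y) \<in> S"
proof -
  have "\<forall>\<^sub>F \<tau> in at_right (0::real). 0 < \<tau>" by (rule eventually_at_right_less)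
  moreover have "\<forall>\<^sub>F \<tau> in at_right (0::real). \<tau> < 1"
    by (rule order_tendstoD(2)[OF tendsto_ident_at]) simp
  ultimately have "\<forall>\<^sub>F \<tau> in at_right (0::real). 0 < \<tau> \<and> \<tau> \<le> 1 \<and>
      y + \<tau> *\<^sub>R (z - y) \<in> S \<and> y + \<tau> *\<^sub>R (z' - y) \<in> S"
    using eventually_scaled_in_interior[OF assms, of z] eventually_scaled_in_interior[OF assms, of z']
    by eventually_elim auto
  from eventually_happens'[OF trivial_limit_at_right_real this] that show ?thesis by blast
qed

lemma affine_along:
  assumes "affine l" "y \<in> l" "z \<in> l"
  shows "y + t *\<^sub>R (z - y) \<in> l"
  using mem_affine[OF assms, of "1 - t" t] by (simp add: algebra_simps)

locale finite_min_loc_concave =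
  fixes \<Omega> :: "'a::euclidean_space set" and f :: "'a \<Rightarrow> ereal"
  assumes finite_B: "\<forall>y\<in>interior \<Omega>. \<bar>min_loc_concave \<Omega> f y\<bar> \<noteq> \<infinity>"
begin

abbreviation "B \<equiv> min_loc_concave \<Omega> f"
abbreviation "G \<equiv> E_pos \<Omega> f"

text \<open>
  The real values of the minimal function, meaningful in the interior of \<open>\<Omega>\<close> only, where that
  function is finite.
\<close>
definition b :: "'a \<Rightarrow> real" where "b y = real_of_ereal (B y)"

lemma B_eq: "y \<in> interior \<Omega> \<Longrightarrow> B y = ereal (b y)"
  using finite_B by (auto simp: b_def ereal_real')

lemma G_subset: "G \<subseteq> interior \<Omega>"
  by (auto simp: E_pos_def)

lemma B_eq_G: "y \<in> G \<Longrightarrow> B y = ereal (b y)"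
  using B_eq G_subset by blast

lemma concave_b:
  assumes "convex W" "W \<subseteq> interior \<Omega>" "y \<in> W" "z \<in> W" "0 \<le> t" "t \<le> 1"
  shows "(1 - t) * b y + t * b z \<le> b ((1 - t) *\<^sub>R y + t *\<^sub>R z)"
proof -
  have seg: "closed_segment y z \<subseteq> W" using assms by (simp add: closed_segment_subset)
  hence "closed_segment y z \<subseteq> \<Omega>" using assms interior_subset by blast
  moreover have "ereal (b y) \<le> B y" "ereal (b z) \<le> B z" using assms B_eq by auto
  ultimately have "ereal ((1 - t) * b y + t * b z) \<le> B ((1 - t) *\<^sub>R y + t *\<^sub>R z)"
    using assms(5,6) by (intro locally_concave_onD[OF locally_concave_min_loc_concave])
  moreover have "(1 - t) *\<^sub>R y + t *\<^sub>R z \<in> interior \<Omega>"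
    using convexD_alt[OF assms(1,3,4)] assms by blast
  ultimately show ?thesis using B_eq by simp
qed

lemma concave_b_along:
  assumes "convex W" "W \<subseteq> interior \<Omega>" "y \<in> W" "z \<in> W" "0 \<le> t" "t \<le> 1"
  shows "(1 - t) * b y + t * b z \<le> b (y + t *\<^sub>R (z - y))"
proof -
  have "y + t *\<^sub>R (z - y) = (1 - t) *\<^sub>R y + t *\<^sub>R z" by (simp add: algebra_simps)
  thus ?thesis by (simp only: concave_b[OF assms])
qed

lemma continuous_on_b: "continuous_on (interior \<Omega>) b"
  unfolding continuous_on_eq_continuous_at[OF open_interior]
proof
  fix y assume "y \<in> interior \<Omega>"
  then obtain \<epsilon> where \<epsilon>: "\<epsilon> > 0" "ball y \<epsilon> \<subseteq> interior \<Omega>"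
    using open_contains_ball open_interior by blast
  have "convex_on (ball y \<epsilon>) (\<lambda>z. - b z)"
  proof (rule convex_onI)
    fix t u v assume "0 < t" "t < (1::real)" "u \<in> ball y \<epsilon>" "v \<in> ball y \<epsilon>"
    thus "- b ((1 - t) *\<^sub>R u + t *\<^sub>R v) \<le> (1 - t) * - b u + t * - b v"
      using concave_b[OF convex_ball \<epsilon>(2), of u v t] by simp
  qed simp
  hence "continuous_on (ball y \<epsilon>) (\<lambda>z. - b z)" by (intro convex_on_continuous) auto
  hence "continuous_on (ball y \<epsilon>) (\<lambda>z. - (- b z))" by (rule continuous_on_minus)
  thus "isCont b y" using \<epsilon> by (simp add: continuous_on_eq_continuous_at)
qed

lemma usc_majorant_le:
  assumes "open N" "y \<in> N" "\<And>z. z \<in> N \<Longrightarrow> z \<in> \<Omega> \<Longrightarrow> f z \<le> c"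
  shows "usc_majorant \<Omega> f y \<le> c"
  unfolding usc_majorant_def
proof (rule Limsup_bounded)
  show "\<forall>\<^sub>F z in inf (nhds y) (principal \<Omega>). f z \<le> c"
    unfolding eventually_inf_principal using eventually_nhds_in_open[OF assms(1,2)]
    by eventually_elim (use assms(3) in blast)
qed

lemma usc_majorant_le_B:
  assumes y: "y \<in> interior \<Omega>"
  shows "usc_majorant \<Omega> f y \<le> B y"
proof (rule ereal_le_epsilon2)
  fix e :: real assume e: "0 < e"
  let ?N = "{z \<in> interior \<Omega>. b z < b y + e}"
  have "open (b -` {..< b y + e} \<inter> interior \<Omega>)"
    using continuous_on_b continuous_on_open_vimage[OF open_interior] open_lessThan by blast
  moreover have "b -` {..< b y + e} \<inter> interior \<Omega> = ?N" by auto
  ultimately have "open ?N" by simp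
  moreover have "f z \<le> B y + ereal e" if "z \<in> ?N" "z \<in> \<Omega>" for z
  proof -
    have "f z \<le> B z" using that by (intro le_min_loc_concave)
    also have "\<dots> \<le> B y + ereal e" using that y B_eq by simp
    finally show ?thesis .
  qed
  ultimately show "usc_majorant \<Omega> f y \<le> B y + ereal e"
    using y e by (intro usc_majorant_le[of ?N]) auto
qed

text \<open>
  The strict inequality between the upper semicontinuous majorant and the continuous minimal
  function leaves room for a constant between the two near the point.
\<close>
lemma gap_near:
  assumes y: "y \<in> G"
  shows "\<exists>r \<delta>. 0 < \<delta> \<and> ball y \<delta> \<subseteq> G \<and> (\<forall>z\<in>ball y \<delta>. f z \<le> ereal r \<and> r < b z)"
proof -
  have yi: "y \<in> interior \<Omega>" using y G_subset by blast
  have "usc_majorant \<Omega> f y \<noteq> B y" using y by (auto simp: E_pos_def E_zero_def)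
  hence "usc_majorant \<Omega> f y < B y" using usc_majorant_le_B[OF yi] by simp
  then obtain r where r: "usc_majorant \<Omega> f y < ereal r" "ereal r < B y" using ereal_dense2 by blast
  have "\<forall>\<^sub>F z in inf (nhds y) (principal \<Omega>). f z < ereal r"
    using r(1) unfolding usc_majorant_def by (rule Limsup_lessD)
  hence "\<forall>\<^sub>F z in nhds y. z \<in> \<Omega> \<longrightarrow> f z < ereal r" by (simp add: eventually_inf_principal)
  moreover have "\<forall>\<^sub>F z in nhds y. z \<in> interior \<Omega>" using yi by (intro eventually_nhds_in_open) auto
  moreover have "\<forall>\<^sub>F z in nhds y. r < b z"
  proof -
    have "isCont b y" using continuous_on_b yi by (simp add: continuous_on_eq_continuous_at)
    hence "(b \<longlongrightarrow> b y) (nhds y)" by (simp add: isCont_def tendsto_at_iff_tendsto_nhds)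
    thus ?thesis using r(2) B_eq[OF yi] by (intro order_tendstoD(1)) auto
  qed
  ultimately have "\<forall>\<^sub>F z in nhds y. z \<in> interior \<Omega> \<and> f z < ereal r \<and> r < b z"
    by eventually_elim (use interior_subset in auto)
  then obtain \<delta> where \<delta>: "\<delta> > 0" "\<And>z. dist z y < \<delta> \<Longrightarrow> z \<in> interior \<Omega> \<and> f z < ereal r \<and> r < b z"
    unfolding eventually_nhds_metric by blast
  have "z \<in> G" if z: "z \<in> ball y \<delta>" for z
  proof -
    have zi: "z \<in> interior \<Omega>" "r < b z" using \<delta>(2)[of z] z by (auto simp: dist_commute)
    have "usc_majorant \<Omega> f z \<le> ereal r"
      using \<delta>(2) z by (intro usc_majorant_le[of "ball y \<delta>"]) (auto simp: dist_commute less_imp_le)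
    also have "ereal r < B z" using zi B_eq by simp
    finally show ?thesis using zi by (auto simp: E_pos_def E_zero_def)
  qed
  thus ?thesis using \<delta> by (intro exI[of _ r] exI[of _ \<delta>]) (auto simp: dist_commute less_imp_le)
qed

lemma open_G: "open G"
  unfolding open_contains_ball using gap_near by blast

text \<open>
  An inequality along a segment can only fail at a point of the ball where the affine function is
  the smaller one.  From there, move along the segment in either direction up to the sphere or
  to the endpoint, whichever comes first.  At both places the affine function dominates the chord,
  hence also in between.
\<close>
lemma concave_lowering:
  fixes L :: "'a \<Rightarrow> real"
  assumes L: "affine_functional L" and \<epsilon>: "0 < \<epsilon>" and sub: "cball y \<epsilon> \<subseteq> interior \<Omega>"
    and sphere: "\<And>z. z \<in> sphere y \<epsilon> \<Longrightarrow> b z \<le> L z"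
  shows "locally_concave_on \<Omega> (\<lambda>z. if z \<in> cball y \<epsilon> then min (B z) (ereal (L z)) else B z)"
    (is "locally_concave_on \<Omega> ?B")
  unfolding locally_concave_on_iff
proof (intro allI impI)
  fix a c and t \<alpha> \<gamma> :: real
  assume ac: "closed_segment a c \<subseteq> \<Omega>" and t: "0 \<le> t" "t \<le> (1::real)"
    and \<alpha>: "ereal \<alpha> \<le> ?B a" and \<gamma>: "ereal \<gamma> \<le> ?B c"
  let ?p = "\<lambda>s. (1 - s) *\<^sub>R a + s *\<^sub>R c"
  let ?l = "\<lambda>s. (1 - s) * \<alpha> + s * \<gamma>"
  have "ereal \<alpha> \<le> B a" "ereal \<gamma> \<le> B c" using \<alpha> \<gamma> by (auto split: if_splits)
  hence lB: "ereal (?l s) \<le> B (?p s)" if "0 \<le> s" "s \<le> 1" for s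
    using ac that by (intro locally_concave_onD[OF locally_concave_min_loc_concave])
  have "?l t \<le> L (?p t)" if pW: "?p t \<in> cball y \<epsilon>"
  proof -
    define \<psi> where "\<psi> s = L (?p s) - ?l s" for s
    have psi: "\<psi> s = (L a - \<alpha>) + s * ((L c - \<gamma>) - (L a - \<alpha>))" for s
      unfolding \<psi>_def affine_functional_combination[OF L] by (simp add: algebra_simps)
    have on_sphere: "0 \<le> \<psi> s" if s: "0 \<le> s" "s \<le> 1" "dist y (?p s) = \<epsilon>" for s
    proof -
      have "?p s \<in> sphere y \<epsilon>" using s by simp
      moreover from this have "?p s \<in> interior \<Omega>" using sub sphere_cball by blast
      ultimately have "?l s \<le> L (?p s)"
        using lB[OF s(1,2)] sphere B_eq by (metis ereal_less_eq(3) order_trans)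
      thus ?thesis by (simp add: \<psi>_def)
    qed
    have cont: "continuous_on S (\<lambda>s. dist y (?p s))" for S :: "real set"
      by (intro continuous_intros)
    have "\<exists>s. 0 \<le> s \<and> s \<le> t \<and> 0 \<le> \<psi> s"
    proof (cases "a \<in> cball y \<epsilon>")
      case True
      hence "\<alpha> \<le> L a" using \<alpha> by simp
      thus ?thesis using t by (intro exI[of _ 0]) (simp add: psi)
    next
      case False
      then obtain s where "0 \<le> s" "s \<le> t" "dist y (?p s) = \<epsilon>"
        using IVT2'[of "\<lambda>s. dist y (?p s)" t \<epsilon> 0] pW t cont by auto
      thus ?thesis using on_sphere t by auto
    qed
    then obtain s1 where s1: "s1 \<le> t" "0 \<le> \<psi> s1" by blast
    have "\<exists>s. t \<le> s \<and> s \<le> 1 \<and> 0 \<le> \<psi> s"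
    proof (cases "c \<in> cball y \<epsilon>")
      case True
      hence "\<gamma> \<le> L c" using \<gamma> by simp
      thus ?thesis using t by (intro exI[of _ 1]) (simp add: psi)
    next
      case False
      then obtain s where "t \<le> s" "s \<le> 1" "dist y (?p s) = \<epsilon>"
        using IVT'[of "\<lambda>s. dist y (?p s)" t \<epsilon> 1] pW t cont by auto
      thus ?thesis using on_sphere t by auto
    qed
    then obtain s2 where s2: "t \<le> s2" "0 \<le> \<psi> s2" by blast
    let ?K = "(L c - \<gamma>) - (L a - \<alpha>)"
    have "0 \<le> \<psi> t"
    proof (cases "0 \<le> ?K")
      case True
      hence "s1 * ?K \<le> t * ?K" using s1 by (intro mult_right_mono) auto
      thus ?thesis using s1(2) unfolding psi by linarith
    next
      case False
      hence "s2 * ?K \<le> t * ?K" using s2 by (intro mult_right_mono_neg) auto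
      thus ?thesis using s2(2) unfolding psi by linarith
    qed
    thus ?thesis by (simp add: \<psi>_def)
  qed
  thus "ereal (?l t) \<le> ?B (?p t)" using lB[OF t] by auto
qed

text \<open>
  An extreme point of the contact set can be separated from the hull of the
  contact points on a small sphere around it.  Off these contact points \<open>L - b\<close> is positive, so
  by compactness a small tilt of \<open>L\<close> about the separating hyperplane still dominates the minimal
  function on the sphere, whereas it is smaller at the centre.  Since the minimal function
  exceeds \<open>f\<close> near \<open>y\<close> by a margin, the lowered function of the preceding lemma is
  admissible.
\<close>
lemma no_extreme_contact:
  fixes L :: "'a \<Rightarrow> real"
  assumes L: "affine_functional L" and \<epsilon>0: "0 < \<epsilon>0" and sub0: "cball y \<epsilon>0 \<subseteq> G"
    and le0: "\<And>z. z \<in> cball y \<epsilon>0 \<Longrightarrow> b z \<le> L z" and y: "b y = L y"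
  shows "\<not> y extreme_point_of {z \<in> cball y \<epsilon>0. b z = L z}"
proof
  assume ext: "y extreme_point_of {z \<in> cball y \<epsilon>0. b z = L z}"
  have yG: "y \<in> G" using sub0 \<epsilon>0 by auto
  obtain r \<delta> where \<delta>: "0 < \<delta>" "\<And>z. z \<in> ball y \<delta> \<Longrightarrow> f z \<le> ereal r \<and> r < b z"
    using gap_near[OF yG] by blast
  have ry: "r < L y" using \<delta>(2)[of y] \<delta>(1) y by simp
  define r' where "r' = (r + L y) / 2"
  have r': "r < r'" "r' < L y" using ry by (auto simp: r'_def)
  have "isCont L y"
    using continuous_on_affine_functional[OF L, of UNIV] by (simp add: continuous_on_eq_continuous_at)
  hence "\<forall>\<^sub>F z in nhds y. r' < L z"
    using r'(2) by (intro order_tendstoD(1)) (auto simp: isCont_def tendsto_at_iff_tendsto_nhds)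
  then obtain \<delta>' where \<delta>': "0 < \<delta>'" "\<And>z. dist z y < \<delta>' \<Longrightarrow> r' < L z"
    unfolding eventually_nhds_metric by blast
  define \<epsilon> where "\<epsilon> = min \<epsilon>0 (min (\<delta> / 2) (\<delta>' / 2))"
  have \<epsilon>: "0 < \<epsilon>" "\<epsilon> \<le> \<epsilon>0" "\<epsilon> < \<delta>" "\<epsilon> < \<delta>'" using \<epsilon>0 \<delta> \<delta>' by (auto simp: \<epsilon>_def)
  let ?W = "cball y \<epsilon>"
  have W: "?W \<subseteq> G" "?W \<subseteq> cball y \<epsilon>0" using \<epsilon> sub0 by auto
  have Wi: "?W \<subseteq> interior \<Omega>" using W G_subset by blast
  have le: "b z \<le> L z" if "z \<in> ?W" for z using le0 W that by blast
  have contb: "continuous_on ?W b" using continuous_on_b Wi by (rule continuous_on_subset)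
  have contL: "continuous_on S L" for S by (rule continuous_on_affine_functional[OF L])
  let ?D = "\<lambda>z. L z - b z"
  let ?S = "sphere y \<epsilon>"
  have SW: "?S \<subseteq> ?W" by (rule sphere_cball)
  have contD: "continuous_on ?S ?D"
    by (intro continuous_on_diff contL continuous_on_subset[OF contb SW])
  define Q where "Q = {z \<in> ?S. ?D z = 0}"
  have "compact Q"
  proof -
    have "closedin (top_of_set ?S) (?S \<inter> ?D -` {0})"
      by (rule continuous_closedin_preimage[OF contD]) simp
    moreover have "?S \<inter> ?D -` {0} = Q" by (auto simp: Q_def)
    ultimately show ?thesis using closedin_compact[OF compact_sphere] by metis
  qed
  have "y \<notin> convex hull Q"
  proof
    assume yQ: "y \<in> convex hull Q"
    have QU: "Q \<subseteq> {z \<in> cball y \<epsilon>0. b z = L z}" using SW W by (auto simp: Q_def)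
    have yU: "y \<in> {z \<in> cball y \<epsilon>0. b z = L z}" using ext by (simp add: extreme_point_of_def)
    have cU: "convex {z \<in> cball y \<epsilon>0. b z = L z}"
    proof (rule convexI)
      fix p q and u v :: real
      assume pq: "p \<in> {z \<in> cball y \<epsilon>0. b z = L z}" "q \<in> {z \<in> cball y \<epsilon>0. b z = L z}"
        and uv: "0 \<le> u" "0 \<le> v" "u + v = 1"
      have u: "u = 1 - v" using uv by simp
      have m: "(1 - v) *\<^sub>R p + v *\<^sub>R q \<in> cball y \<epsilon>0"
        using pq uv by (intro convexD_alt convex_cball) auto
      have "L ((1 - v) *\<^sub>R p + v *\<^sub>R q) \<le> b ((1 - v) *\<^sub>R p + v *\<^sub>R q)"
        using concave_b[OF convex_cball, of y \<epsilon>0 p q v] pq uv sub0 G_subset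
        unfolding affine_functional_combination[OF L] by auto
      thus "u *\<^sub>R p + v *\<^sub>R q \<in> {z \<in> cball y \<epsilon>0. b z = L z}"
        using m le0[OF m] unfolding u by auto
    qed
    have "y extreme_point_of (convex hull Q)"
      using ext yQ hull_minimal[of Q _ convex, OF QU cU] unfolding extreme_point_of_def by blast
    hence "y \<in> Q" by (rule extreme_point_of_convex_hull)
    thus False using \<epsilon> by (simp add: Q_def)
  qed
  moreover have "closed (convex hull Q)"
    using \<open>compact Q\<close> by (intro compact_imp_closed compact_convex_hull)
  ultimately obtain a s where as: "a \<bullet> y < s" "\<And>z. z \<in> convex hull Q \<Longrightarrow> s < a \<bullet> z"
    using separating_hyperplane_closed_point[OF convex_convex_hull] by blast
  let ?h = "\<lambda>z. a \<bullet> z - s"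
  have hcont: "continuous_on S ?h" for S by (intro continuous_intros)
  obtain M where M: "0 < M" "\<And>z. z \<in> ?W \<Longrightarrow> \<bar>?h z\<bar> \<le> M"
  proof -
    have "bounded (?h ` ?W)"
      by (intro compact_imp_bounded compact_continuous_image hcont compact_cball)
    then obtain M where "0 < M" "\<forall>x\<in>?h ` ?W. norm x \<le> M" unfolding bounded_pos by blast
    thus ?thesis using that[of M] by auto
  qed
  obtain m where m: "0 < m" "\<And>z. z \<in> ?S \<Longrightarrow> ?h z \<le> 0 \<Longrightarrow> m \<le> ?D z"
  proof -
    let ?N = "?S \<inter> {z. a \<bullet> z \<le> s}"
    have cN: "compact ?N" by (intro compact_Int_closed compact_sphere closed_halfspace_le)
    have pos: "0 < ?D z" if "z \<in> ?N" for z
    proof -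
      have "z \<notin> Q" using as(2)[of z] that by (auto simp: hull_inc)
      moreover have "b z \<le> L z" using that SW le by blast
      ultimately show ?thesis using that by (auto simp: Q_def)
    qed
    show ?thesis
    proof (cases "?N = {}")
      case True
      show ?thesis by (rule that[of 1]) (use True in auto)
    next
      case False
      have "continuous_on ?N ?D" using contD by (rule continuous_on_subset) auto
      then obtain z0 where z0: "z0 \<in> ?N" "\<And>z. z \<in> ?N \<Longrightarrow> ?D z0 \<le> ?D z"
        using continuous_attains_inf[OF cN False] by blast
      show ?thesis using that[OF pos[OF z0(1)]] z0(2) by auto
    qed
  qed
  define \<kappa> where "\<kappa> = min (m / M) ((r' - r) / M)"
  have \<kappa>: "0 < \<kappa>" "\<kappa> * M \<le> m" "\<kappa> * M \<le> r' - r"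
  proof -
    show "0 < \<kappa>" using m M r' by (simp add: \<kappa>_def)
    have "\<kappa> \<le> m / M" "\<kappa> \<le> (r' - r) / M" by (simp_all add: \<kappa>_def)
    thus "\<kappa> * M \<le> m" "\<kappa> * M \<le> r' - r"
      using M(1) by (simp_all add: pos_le_divide_eq)
  qed
  let ?L = "\<lambda>z. L z + \<kappa> * ?h z"
  have L': "affine_functional ?L"
  proof -
    obtain g c where g: "linear g" "L = (\<lambda>x. g x + c)" using L by (auto simp: affine_functional_def)
    have "linear (\<lambda>z. g z + \<kappa> * (a \<bullet> z))"
      using g(1) by (intro linearI) (auto simp: linear_add linear_scale inner_add_right algebra_simps)
    moreover have "?L = (\<lambda>z. (g z + \<kappa> * (a \<bullet> z)) + (c - \<kappa> * s))"
      by (auto simp: g(2) algebra_simps)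
    ultimately show ?thesis unfolding affine_functional_def by blast
  qed
  have hM: "- (\<kappa> * M) \<le> \<kappa> * ?h z" if "z \<in> ?W" for z
  proof -
    have "\<kappa> * (- M) \<le> \<kappa> * ?h z" using M(2)[OF that] \<kappa>(1) by (intro mult_left_mono) auto
    thus ?thesis by simp
  qed
  have sph: "b z \<le> ?L z" if z: "z \<in> ?S" for z
  proof (cases "?h z \<le> 0")
    case True
    thus ?thesis using m(2)[OF z True] hM[of z] \<kappa>(2) z SW by auto
  next
    case False
    hence "0 \<le> \<kappa> * ?h z" using \<kappa>(1) by simp
    thus ?thesis using le[of z] z SW by auto
  qed
  let ?B = "\<lambda>z. if z \<in> ?W then min (B z) (ereal (?L z)) else B z"
  have "B y \<le> ?B y"
  proof (rule min_loc_concave_le[where B="?B"])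
    show "locally_concave_on \<Omega> ?B" by (rule concave_lowering[OF L' \<epsilon>(1) Wi sph])
    fix z assume z: "z \<in> \<Omega>"
    have fB: "f z \<le> B z" using z by (rule le_min_loc_concave)
    show "f z \<le> ?B z"
    proof (cases "z \<in> ?W")
      case True
      hence "f z \<le> ereal r" using \<delta>(2)[of z] \<epsilon>(3) by auto
      also have "r \<le> ?L z"
        using hM[OF True] \<kappa>(3) \<delta>'(2)[of z] True \<epsilon>(4) by (auto simp: dist_commute)
      finally show ?thesis using fB True by simp
    next
      case False
      thus ?thesis using fB by simp
    qed
  qed
  moreover have "y \<in> ?W" using \<epsilon> by simp
  ultimately have "b y \<le> ?L y" using B_eq_G[OF yG] by simp
  moreover have "\<kappa> * ?h y < 0" using \<kappa>(1) as(1) by (simp add: mult_less_0_iff)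
  ultimately show False using y by linarith
qed

section \<open>The contact sets near a pre-extremal point\<close>

text \<open>
  The condition on the neighbourhood in the definition of the pre-extremal set, in terms of the real-valued
  function \<open>b\<close>.
\<close>
definition witness :: "('a \<Rightarrow> real) \<Rightarrow> 'a set \<Rightarrow> 'a set \<Rightarrow> 'a \<Rightarrow> bool" where
  "witness L l W y \<longleftrightarrow> closed W \<and> convex W \<and> W \<subseteq> G \<and> y \<in> interior W \<and> y \<in> l \<and>
     (\<forall>z\<in>W. b z \<le> L z) \<and> b y = L y \<and>
     (l \<inter> {z \<in> W. b z = L z}) face_of {z \<in> W. b z = L z} \<and>
     affine hull (l \<inter> {z \<in> W. b z = L z}) = l"

lemma contact_set_eq:
  assumes "W \<subseteq> G"
  shows "contact_set \<Omega> f W L = {z \<in> W. b z = L z}"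
  using B_eq_G assms by (auto simp: contact_set_def)

lemma pre_extremal_iff_witness:
  "y \<in> pre_extremal_set \<Omega> f L l \<longleftrightarrow> (\<exists>W. witness L l W y)"
proof
  assume "y \<in> pre_extremal_set \<Omega> f L l"
  then obtain W where W: "y \<in> l" "closed W" "convex W" "W \<subseteq> G" "y \<in> interior W"
    "\<forall>z\<in>W. B z \<le> ereal (L z)" "y \<in> contact_set \<Omega> f W L"
    "(l \<inter> contact_set \<Omega> f W L) face_of (contact_set \<Omega> f W L)"
    "affine hull (l \<inter> contact_set \<Omega> f W L) = l"
    by (auto simp: pre_extremal_set_def)
  have "\<forall>z\<in>W. b z \<le> L z" using W(4,6) B_eq_G by force
  hence "witness L l W y"
    using W unfolding witness_def contact_set_eq[OF W(4)] by simp
  thus "\<exists>W. witness L l W y" ..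
next
  assume "\<exists>W. witness L l W y"
  then obtain W where W: "witness L l W y" ..
  hence WG: "W \<subseteq> G" by (simp add: witness_def)
  have yW: "y \<in> W" using W interior_subset by (auto simp: witness_def)
  have "\<forall>z\<in>W. B z \<le> ereal (L z)" using W B_eq_G by (force simp: witness_def)
  thus "y \<in> pre_extremal_set \<Omega> f L l"
    using W WG yW unfolding pre_extremal_set_def
    by (intro CollectI conjI exI[of _ W]) (auto simp: witness_def contact_set_eq)
qed

lemma contact_along:
  assumes L: "affine_functional L" and W: "convex W" "W \<subseteq> G" and yz: "y \<in> W" "z \<in> W" "b y = L y" "b z = L z"
    and t: "0 \<le> t" "t \<le> 1" and le: "b (y + t *\<^sub>R (z - y)) \<le> L (y + t *\<^sub>R (z - y))"
  shows "b (y + t *\<^sub>R (z - y)) = L (y + t *\<^sub>R (z - y))"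
  using concave_b_along[OF W(1) order_trans[OF W(2) G_subset] yz(1,2) t] le yz
  unfolding affine_functional_along[OF L] by simp

lemma convex_contact:
  assumes L: "affine_functional L" and W: "convex W" "W \<subseteq> G" and le: "\<forall>z\<in>W. b z \<le> L z"
  shows "convex {z \<in> W. b z = L z}"
proof (rule convexI)
  fix y z and u v :: real
  assume yz: "y \<in> {z \<in> W. b z = L z}" "z \<in> {z \<in> W. b z = L z}" and uv: "0 \<le> u" "0 \<le> v" "u + v = 1"
  have u: "u = 1 - v" using uv(3) by simp
  have eq: "u *\<^sub>R y + v *\<^sub>R z = y + v *\<^sub>R (z - y)" unfolding u by (simp add: algebra_simps)
  have m: "y + v *\<^sub>R (z - y) \<in> W"
    using convexD[OF W(1), of y z u v] yz uv unfolding eq by auto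
  have "b (y + v *\<^sub>R (z - y)) = L (y + v *\<^sub>R (z - y))"
    using yz uv le m by (intro contact_along[OF L W]) auto
  thus "u *\<^sub>R y + v *\<^sub>R z \<in> {z \<in> W. b z = L z}" unfolding eq using m by simp
qed

text \<open>
  Both neighbourhoods contain a small homothetic copy, centred at \<open>y\<close>, of any finite
  configuration in the other.  Along a segment that starts at the contact point \<open>y\<close> a concave
  function below \<open>L\<close> at one interior point is below \<open>L\<close> at the far end, and it touches \<open>L\<close> on the
  whole segment if it does so at the end.
\<close>
lemma witness_transfer:
  assumes L: "affine_functional L" and l: "affine l" and w0: "witness L l W0 y"
    and W: "closed W" "convex W" "W \<subseteq> G" "y \<in> interior W"
  shows "witness L l W y"
proof -
  have W0: "convex W0" "W0 \<subseteq> G" "y \<in> interior W0" and yl: "y \<in> l" and by0: "b y = L y"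
    and le0: "\<And>z. z \<in> W0 \<Longrightarrow> b z \<le> L z"
    and face0: "(l \<inter> {z \<in> W0. b z = L z}) face_of {z \<in> W0. b z = L z}"
    and aff0: "affine hull (l \<inter> {z \<in> W0. b z = L z}) = l"
    using w0 by (auto simp: witness_def)
  have yW: "y \<in> W" "y \<in> W0" using W W0 interior_subset by auto
  have along: "y + t *\<^sub>R (z - y) \<in> V" if "convex V" "y \<in> V" "z \<in> V" "0 \<le> t" "t \<le> 1" for t z V
    using convexD_alt[OF that] by (simp add: algebra_simps)
  have le: "b z \<le> L z" if z: "z \<in> W" for z
  proof -
    obtain \<tau> where \<tau>: "0 < \<tau>" "\<tau> \<le> 1" "y + \<tau> *\<^sub>R (z - y) \<in> W0"
      using scaled_in_interior2[OF W0(3), of z z] by blast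
    have "(1 - \<tau>) * b y + \<tau> * b z \<le> b (y + \<tau> *\<^sub>R (z - y))"
      using concave_b_along[OF W(2) order_trans[OF W(3) G_subset] yW(1) z] \<tau> by auto
    also have "\<dots> \<le> L (y + \<tau> *\<^sub>R (z - y))" by (rule le0[OF \<tau>(3)])
    also have "\<dots> = (1 - \<tau>) * b y + \<tau> * L z" unfolding affine_functional_along[OF L] by0 ..
    finally show ?thesis using \<tau>(1) by simp
  qed
  have face: "(l \<inter> {z \<in> W. b z = L z}) face_of {z \<in> W. b z = L z}"
    unfolding face_of_def
  proof (intro conjI ballI impI)
    show "l \<inter> {z \<in> W. b z = L z} \<subseteq> {z \<in> W. b z = L z}" by blast
    show "convex (l \<inter> {z \<in> W. b z = L z})"
      using le by (intro convex_Int affine_imp_convex[OF l] convex_contact[OF L W(2,3)]) auto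
    fix p q r
    assume p: "p \<in> {z \<in> W. b z = L z}" and q: "q \<in> {z \<in> W. b z = L z}"
      and r: "r \<in> l \<inter> {z \<in> W. b z = L z}" "r \<in> open_segment p q"
    obtain \<tau> where \<tau>: "0 < \<tau>" "\<tau> \<le> 1" "y + \<tau> *\<^sub>R (p - y) \<in> W0" "y + \<tau> *\<^sub>R (q - y) \<in> W0"
      using scaled_in_interior2[OF W0(3), of p q] by blast
    let ?h = "\<lambda>z. y + \<tau> *\<^sub>R (z - y)"
    have hp: "?h p \<in> {z \<in> W0. b z = L z}" and hq: "?h q \<in> {z \<in> W0. b z = L z}"
      using contact_along[OF L W(2,3) yW(1) _ by0] p q \<tau> le0 by auto
    obtain u where u: "0 < u" "u < 1" "r = (1 - u) *\<^sub>R p + u *\<^sub>R q" "p \<noteq> q"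
      using r(2) by (auto simp: in_segment)
    have hr: "?h r = (1 - u) *\<^sub>R ?h p + u *\<^sub>R ?h q" unfolding u(3) by (simp add: algebra_simps)
    have hr_seg: "?h r \<in> open_segment (?h p) (?h q)"
    proof -
      have "?h p \<noteq> ?h q" using u(4) \<tau>(1) by simp
      thus ?thesis unfolding in_segment using u(1,2) hr by blast
    qed
    have "?h r \<in> {z \<in> W0. b z = L z}"
      unfolding hr using hp hq u W0 le0
      by (intro convexD_alt convex_contact[OF L]) auto
    moreover have "?h r \<in> l" using r yl by (intro affine_along[OF l]) auto
    ultimately have "?h p \<in> l \<and> ?h q \<in> l"
      using face_ofD[OF face0 hr_seg hp hq] by blast
    hence hl: "?h p \<in> l" "?h q \<in> l" by simp_all
    have hpq: "y + (1 / \<tau>) *\<^sub>R (?h p - y) \<in> l" "y + (1 / \<tau>) *\<^sub>R (?h q - y) \<in> l"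
      by (rule affine_along[OF l yl hl(1)], rule affine_along[OF l yl hl(2)])
    have rescale: "y + (1 / \<tau>) *\<^sub>R (?h z - y) = z" for z using \<tau>(1) by simp
    have "p \<in> l" "q \<in> l" using hpq unfolding rescale .
    thus "p \<in> l \<inter> {z \<in> W. b z = L z}" "q \<in> l \<inter> {z \<in> W. b z = L z}" using p q by auto
  qed
  have aff: "affine hull (l \<inter> {z \<in> W. b z = L z}) = l"
  proof
    let ?A = "affine hull (l \<inter> {z \<in> W. b z = L z})"
    show "?A \<subseteq> l" by (rule hull_minimal) (use l in auto)
    have yA: "y \<in> ?A" using yl yW by0 by (simp add: hull_inc)
    have "l \<inter> {z \<in> W0. b z = L z} \<subseteq> ?A"
    proof
      fix z assume z: "z \<in> l \<inter> {z \<in> W0. b z = L z}"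
      obtain \<tau> where \<tau>: "0 < \<tau>" "\<tau> \<le> 1" "y + \<tau> *\<^sub>R (z - y) \<in> W"
        using scaled_in_interior2[OF W(4), of z z] by blast
      let ?z = "y + \<tau> *\<^sub>R (z - y)"
      have "b ?z = L ?z"
        using z \<tau> le by (intro contact_along[OF L W0(1,2) yW(2) _ by0]) auto
      moreover have "?z \<in> l" using z yl by (intro affine_along[OF l]) auto
      ultimately have "?z \<in> ?A" using \<tau> by (simp add: hull_inc)
      hence "y + (1 / \<tau>) *\<^sub>R (?z - y) \<in> ?A" by (rule affine_along[OF affine_affine_hull yA])
      moreover have rescale: "y + (1 / \<tau>) *\<^sub>R (?z - y) = z" using \<tau>(1) by simp
      ultimately show "z \<in> ?A" by (simp only: rescale)
    qed
    hence "affine hull (l \<inter> {z \<in> W0. b z = L z}) \<subseteq> ?A" by (rule hull_minimal) simp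
    thus "l \<subseteq> ?A" unfolding aff0 .
  qed
  show ?thesis
    using W yl by0 le face aff by (simp add: witness_def)
qed

lemma witness_shift:
  assumes "witness L l W y" "z \<in> interior W" "z \<in> l" "b z = L z"
  shows "witness L l W z"
  using assms by (simp add: witness_def)

lemma pre_extremal_subset: "pre_extremal_set \<Omega> f L l \<subseteq> G"
  by (auto simp: pre_extremal_set_def)

lemma pre_extremal_closed:
  assumes L: "affine_functional L" and l: "affine l"
  shows "closure (pre_extremal_set \<Omega> f L l) \<inter> G \<subseteq> pre_extremal_set \<Omega> f L l"
proof
  let ?E = "pre_extremal_set \<Omega> f L l"
  fix p assume p: "p \<in> closure ?E \<inter> G"
  obtain \<epsilon> where \<epsilon>: "0 < \<epsilon>" "cball p \<epsilon> \<subseteq> G"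
    using p open_G open_contains_cball by blast
  have int: "interior (cball p \<epsilon>) = ball p \<epsilon>" by (rule interior_cball)
  obtain y where y: "y \<in> ?E" "dist y p < \<epsilon>" using p \<epsilon> closure_approachable by blast
  obtain W0 where "witness L l W0 y" using y pre_extremal_iff_witness by blast
  hence wy: "witness L l (cball p \<epsilon>) y"
    by (rule witness_transfer[OF L l]) (use \<epsilon> y int in \<open>auto simp: dist_commute\<close>)
  have "p \<in> l"
  proof -
    have "?E \<subseteq> l" by (auto simp: pre_extremal_set_def)
    hence "closure ?E \<subseteq> l" using affine_closed[OF l] by (rule closure_minimal)
    thus ?thesis using p by blast
  qed
  moreover have "b p = L p"
  proof -
    obtain Y where Y: "\<And>n. Y n \<in> ?E" "Y \<longlonglongrightarrow> p" using p closure_sequential by blast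
    have "isCont b p"
      using continuous_on_b p G_subset by (auto simp: continuous_on_eq_continuous_at)
    hence "(\<lambda>n. b (Y n)) \<longlonglongrightarrow> b p" using Y(2) by (rule isCont_tendsto_compose)
    moreover have "isCont L p"
      using continuous_on_affine_functional[OF L, of UNIV] by (simp add: continuous_on_eq_continuous_at)
    hence "(\<lambda>n. L (Y n)) \<longlonglongrightarrow> L p" using Y(2) by (rule isCont_tendsto_compose)
    moreover have "b (Y n) = L (Y n)" for n
      using Y(1)[of n] unfolding pre_extremal_iff_witness witness_def by blast
    ultimately show ?thesis using LIMSEQ_unique by simp
  qed
  ultimately have "witness L l (cball p \<epsilon>) p"
    using wy \<epsilon> by (intro witness_shift[OF wy]) auto
  thus "p \<in> ?E" using pre_extremal_iff_witness by blast
qed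

text \<open>
  A tube around the segment is a convex neighbourhood of all its points and serves as a
  common witness.
\<close>
lemma pre_extremal_segment:
  assumes L: "affine_functional L" and l: "affine l"
    and y: "y \<in> pre_extremal_set \<Omega> f L l" and z: "z \<in> pre_extremal_set \<Omega> f L l"
    and seg: "closed_segment y z \<subseteq> G"
  shows "closed_segment y z \<subseteq> pre_extremal_set \<Omega> f L l"
proof -
  obtain \<epsilon> where \<epsilon>: "0 < \<epsilon>" "(\<Union>p\<in>closed_segment y z. ball p \<epsilon>) \<subseteq> G"
    using compact_subset_open_imp_ball_epsilon_subset[OF compact_segment open_G seg] by blast
  define W where "W = (\<Union>p\<in>closed_segment y z. \<Union>q\<in>cball 0 (\<epsilon> / 2). {p + q})"
  have W: "closed W" "convex W"
    unfolding W_def by (intro compact_imp_closed compact_sums' convex_sums; simp)+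
  have WG: "W \<subseteq> G"
  proof
    fix w assume "w \<in> W"
    then obtain p q where pq: "p \<in> closed_segment y z" "norm q \<le> \<epsilon> / 2" "w = p + q"
      by (auto simp: W_def)
    hence "w \<in> ball p \<epsilon>" using \<epsilon> by (simp add: dist_norm)
    thus "w \<in> G" using \<epsilon> pq by blast
  qed
  have int: "p \<in> interior W" if p: "p \<in> closed_segment y z" for p
  proof -
    have "ball p (\<epsilon> / 2) \<subseteq> W"
    proof
      fix w assume "w \<in> ball p (\<epsilon> / 2)"
      hence "w - p \<in> cball 0 (\<epsilon> / 2)" by (simp add: dist_norm norm_minus_commute)
      moreover have "w = p + (w - p)" by simp
      ultimately show "w \<in> W" unfolding W_def using p by blast
    qed
    thus ?thesis using \<epsilon> by (intro interiorI[of "ball p (\<epsilon> / 2)"]) auto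
  qed
  have wit: "witness L l W v" if v: "v \<in> {y, z}" for v
  proof -
    have "v \<in> pre_extremal_set \<Omega> f L l" using v y z by blast
    then obtain W0 where w0: "witness L l W0 v" unfolding pre_extremal_iff_witness by blast
    have "v \<in> closed_segment y z" using v by auto
    thus ?thesis by (intro witness_transfer[OF L l w0 W WG] int)
  qed
  have ends: "y \<in> W" "z \<in> W"
    by (rule subsetD[OF interior_subset int], simp)+
  have "p \<in> pre_extremal_set \<Omega> f L l" if p: "p \<in> closed_segment y z" for p
  proof -
    have yz: "y \<in> l \<inter> {z \<in> W. b z = L z}" "z \<in> l \<inter> {z \<in> W. b z = L z}"
      using wit[of y] wit[of z] ends by (simp_all add: witness_def)
    have cv: "convex (l \<inter> {z \<in> W. b z = L z})"
      using wit[of y]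
      by (intro convex_Int affine_imp_convex[OF l] convex_contact[OF L W(2) WG]) (auto simp: witness_def)
    have pm: "p \<in> l \<inter> {z \<in> W. b z = L z}"
      using p closed_segment_subset[OF yz cv] by blast
    have "witness L l W y" by (rule wit) simp
    hence "witness L l W p" by (rule witness_shift) (use pm int[OF p] in simp_all)
    thus ?thesis unfolding pre_extremal_iff_witness by blast
  qed
  thus ?thesis by blast
qed

lemma pre_extremal_not_extreme:
  assumes L: "affine_functional L" and l: "affine l" and y: "y \<in> pre_extremal_set \<Omega> f L l"
  shows "\<exists>u. u \<noteq> 0 \<and> closed_segment (y - u) (y + u) \<subseteq> pre_extremal_set \<Omega> f L l"
proof -
  obtain W0 where w0: "witness L l W0 y" using y pre_extremal_iff_witness by blast
  have "y \<in> G" using y pre_extremal_subset by blast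
  then obtain \<epsilon> where \<epsilon>: "0 < \<epsilon>" "cball y \<epsilon> \<subseteq> G" using open_G open_contains_cball by blast
  let ?W = "cball y \<epsilon>"
  let ?U = "{z \<in> ?W. b z = L z}"
  have w: "witness L l ?W y"
    by (rule witness_transfer[OF L l w0]) (use \<epsilon> in \<open>auto simp: interior_cball\<close>)
  hence le: "\<And>z. z \<in> ?W \<Longrightarrow> b z \<le> L z" and by0: "b y = L y" and yl: "y \<in> l"
    and face: "(l \<inter> ?U) face_of ?U" by (auto simp: witness_def)
  have yU: "y \<in> ?U" using \<epsilon> by0 by simp
  have "\<not> y extreme_point_of ?U" by (rule no_extreme_contact[OF L \<epsilon> le by0])
  then obtain p q where pq: "p \<in> ?U" "q \<in> ?U" "y \<in> open_segment p q"
    using yU unfolding extreme_point_of_def by blast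
  have pql: "p \<in> l \<inter> ?U" "q \<in> l \<inter> ?U"
    using face_ofD[OF face pq(3,1,2)] yU yl by blast+
  have cvU: "convex (l \<inter> ?U)" using face face_of_imp_convex by blast
  obtain t where t: "0 < t" "t < 1" "y = (1 - t) *\<^sub>R p + t *\<^sub>R q" "p \<noteq> q"
    using pq(3) by (auto simp: in_segment)
  define s where "s = min (min t (1 - t)) (\<epsilon> / (2 * norm (q - p)))"
  define u where "u = s *\<^sub>R (q - p)"
  have s: "0 < s" "s \<le> t" "s \<le> 1 - t" using t \<epsilon> by (auto simp: s_def)
  have nu: "norm u < \<epsilon>"
  proof -
    have "norm u = s * norm (q - p)" using s by (simp add: u_def)
    also have "\<dots> \<le> \<epsilon> / (2 * norm (q - p)) * norm (q - p)"
      by (intro mult_right_mono) (auto simp: s_def)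
    also have "\<dots> < \<epsilon>" using t \<epsilon> by simp
    finally show ?thesis .
  qed
  have mem: "y + r *\<^sub>R u \<in> pre_extremal_set \<Omega> f L l" if r: "\<bar>r\<bar> \<le> 1" for r
  proof -
    have "\<bar>r * s\<bar> \<le> s" using r s by (simp add: abs_mult mult_left_le_one_le)
    hence rs: "0 \<le> t + r * s" "t + r * s \<le> 1" using s by linarith+
    have "y + r *\<^sub>R u = (1 - (t + r * s)) *\<^sub>R p + (t + r * s) *\<^sub>R q"
      unfolding t(3) u_def by (simp add: algebra_simps)
    hence "y + r *\<^sub>R u \<in> l \<inter> ?U" using convexD_alt[OF cvU pql rs] by simp
    moreover have "y + r *\<^sub>R u \<in> interior ?W"
    proof -
      have "norm (r *\<^sub>R u) \<le> norm u" using r by (simp add: mult_left_le_one_le)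
      thus ?thesis using nu by (simp add: interior_cball dist_norm)
    qed
    ultimately have "witness L l ?W (y + r *\<^sub>R u)" by (intro witness_shift[OF w]) auto
    thus ?thesis unfolding pre_extremal_iff_witness by blast
  qed
  have "closed_segment (y - u) (y + u) \<subseteq> pre_extremal_set \<Omega> f L l"
  proof
    fix v assume "v \<in> closed_segment (y - u) (y + u)"
    then obtain r where r: "0 \<le> r" "r \<le> 1" "v = (1 - r) *\<^sub>R (y - u) + r *\<^sub>R (y + u)"
      by (auto simp: closed_segment_def)
    have dbl: "(2 * r) *\<^sub>R u = r *\<^sub>R u + r *\<^sub>R u" by (simp only: mult_2 scaleR_add_left)
    have "v = y + (2 * r - 1) *\<^sub>R u"
      unfolding r(3) by (simp add: scaleR_diff_left scaleR_diff_right scaleR_add_right dbl)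
    thus "v \<in> pre_extremal_set \<Omega> f L l" using mem[of "2 * r - 1"] r by auto
  qed
  moreover have "u \<noteq> 0" using s t by (simp add: u_def)
  ultimately show ?thesis by blast
qed

end

text \<open>
  The three properties hold for the pre-extremal set and pass to its connected components,
  as segments are connected and adding a limit point to a connected set keeps it connected.
\<close>
lemma (in finite_min_loc_concave) extremal_set_extreme_point_free:
  assumes L: "affine_functional L" and l: "affine l"
  shows "extreme_point_free G (extremal_set \<Omega> f x L l)"
proof -
  let ?P = "pre_extremal_set \<Omega> f L l" and ?E = "extremal_set \<Omega> f x L l"
  have EP: "?E \<subseteq> ?P" unfolding extremal_set_def by (rule connected_component_subset)
  have absorb: "T \<subseteq> ?E" if "connected T" "T \<subseteq> ?P" "y \<in> T" "y \<in> ?E" for T y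
  proof -
    have "connected_component_set ?P y = ?E"
      using that(4) unfolding extremal_set_def by (rule connected_component_eq)
    thus ?thesis using connected_component_maximal[OF that(3,1,2)] by simp
  qed
  show ?thesis
  proof
    show "open G" by (rule open_G)
    show "?E \<subseteq> G" using EP pre_extremal_subset by blast
    show "closure ?E \<inter> G \<subseteq> ?E"
    proof
      fix p assume p: "p \<in> closure ?E \<inter> G"
      hence pP: "p \<in> ?P" using pre_extremal_closed[OF L l] closure_mono[OF EP] by blast
      obtain e where e: "e \<in> ?E" using p by (metis IntD1 closure_empty empty_iff ex_in_conv)
      have "connected ?E" unfolding extremal_set_def by (rule connected_connected_component)
      hence "connected (insert p ?E)"
        by (rule connected_intermediate_closure) (use p closure_subset in auto)
      hence "insert p ?E \<subseteq> ?E"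
        by (rule absorb[of _ e]) (use pP EP e in auto)
      thus "p \<in> ?E" by blast
    qed
    show "closed_segment y z \<subseteq> ?E" if "y \<in> ?E" "z \<in> ?E" "closed_segment y z \<subseteq> G" for y z
    proof (rule absorb[of _ y])
      show "closed_segment y z \<subseteq> ?P"
        by (rule pre_extremal_segment[OF L l]) (use that EP in auto)
    qed (use that in auto)
    show "\<exists>u. u \<noteq> 0 \<and> closed_segment (y - u) (y + u) \<subseteq> ?E" if y: "y \<in> ?E" for y
    proof -
      obtain u where u: "u \<noteq> 0" "closed_segment (y - u) (y + u) \<subseteq> ?P"
        using pre_extremal_not_extreme[OF L l] y EP by blast
      have "midpoint (y - u) (y + u) = y" by (simp add: midpoint_def scaleR_2[symmetric])
      hence "y \<in> closed_segment (y - u) (y + u)" by (metis midpoint_in_closed_segment)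
      hence "closed_segment (y - u) (y + u) \<subseteq> ?E"
        using u y by (intro absorb[of _ y]) auto
      thus ?thesis using u by blast
    qed
  qed
qed

section \<open>Simplices and lines in extremal sets\<close>

theorem theorem12p2:
  fixes \<Omega> :: "'a::euclidean_space set"
    and f :: "'a \<Rightarrow> ereal"
    and L :: "'a \<Rightarrow> real"
    and l :: "'a set"
    and x :: 'a
  assumes finite_B: "\<forall>y\<in>interior \<Omega>. \<bar>min_loc_concave \<Omega> f y\<bar> \<noteq> \<infinity>"
    and L: "affine_functional L"
    and l: "affine l"
    and x: "x \<in> pre_extremal_set \<Omega> f L l"
  shows "((\<exists>m. affine m \<and> aff_dim m = 1 \<and> x \<in> m \<and> m \<subseteq> extremal_set \<Omega> f x L l) \<or>
          (\<exists>C V D. gen_simplex C V D \<and> x \<in> rel_interior C \<and>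
             V \<subseteq> frontier (E_pos \<Omega> f) \<and> C \<subseteq> closure (extremal_set \<Omega> f x L l))) \<and>
         ((\<exists>C V D. gen_simplex C V D \<and> x \<in> rel_interior C \<and>
             V \<subseteq> frontier (E_pos \<Omega> f) \<and> C \<subseteq> closure (extremal_set \<Omega> f x L l)) \<longrightarrow>
          (\<exists>C V D. gen_simplex C V D \<and> x \<in> rel_interior C \<and>
             V \<subseteq> frontier (E_pos \<Omega> f) \<and> C \<subseteq> closure (extremal_set \<Omega> f x L l) \<and>
             C - V \<subseteq> extremal_set \<Omega> f x L l \<and> card D \<le> 1))"
proof -
  let ?G = "E_pos \<Omega> f" and ?E = "extremal_set \<Omega> f x L l"
  interpret finite_min_loc_concave \<Omega> f by unfold_locales (rule finite_B)
  interpret E: extreme_point_free ?G ?E by (rule extremal_set_extreme_point_free[OF L l])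
  have xE: "x \<in> ?E" using x unfolding extremal_set_def by simp
  let ?simplex = "\<lambda>C V D. gen_simplex C V D \<and> x \<in> rel_interior C \<and> V \<subseteq> frontier ?G \<and> C \<subseteq> closure ?E"
  let ?good = "\<exists>C V D. gen_simplex C V D \<and> x \<in> rel_interior C \<and> V \<subseteq> frontier ?G \<and>
    C \<subseteq> closure ?E \<and> C - V \<subseteq> ?E \<and> card D \<le> 1"
  have good: "?good" if "(1, x) \<in> convex_cone hull (E.horizon x)"
    by (rule E.simplex_if_balanced[OF xE that])
  have "(\<exists>m. affine m \<and> aff_dim m = 1 \<and> x \<in> m \<and> m \<subseteq> ?E) \<or> (\<exists>C V D. ?simplex C V D)"
    using E.line_or_balanced[OF xE] good by blast
  moreover have ?good if "\<exists>C V D. ?simplex C V D"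
  proof -
    from that obtain C V D where CVD: "?simplex C V D" by blast
    hence "x \<in> C" using rel_interior_subset by blast
    thus ?thesis using CVD by (intro good E.balanced_if_simplex[of C V D]) auto
  qed
  ultimately show ?thesis by blast
qed

end
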